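(* Let $n\ge 1$ and let $\beta,\beta_1,\dots,\beta_n$ be integers such that $$K=C(\beta,\beta_n,\dots,\beta_2,\beta_1,1,1,1,1,1,1-\beta_1,-\beta_2,\dots,-\beta_n)$$ is a nontrivial two-bridge knot. (The sequence has $2n+6$ entries: $\beta$, then $\beta_n,\dots,\beta_1$, then five entries equal to $1$, then $1-\beta_1,-\beta_2,\dots,-\beta_n$.) Then $u^{\Delta}(K)=1$.
   Context: Knots are in $S^3$ and considered up to ambient isotopy. $\Delta$-move: a local move on diagrams of oriented knots. In a disk the diagram consists of three arcs, each two of which cross exactly once, the three crossings being the vertices of a triangle, and with cyclic over/under information (each arc passes over one of the other two and under the remaining one). The move replaces this by the picture obtained by pushing one arc across the crossing of the other two, keeping for each pair of arcs which one is over. In terms of 3-string tangles it replaces the braid $\sigma_1\sigma_2^{-1}\sigma_1$ by $\sigma_2\sigma_1^{-1}\sigma_2$ (or the mirror image, or inverse, of this replacement); the orientations of the arcs are arbitrary. Any two knots are related by finitely many $\Delta$-moves (and isotopy). The $\Delta$-Gordian distance $d_G^{\Delta}(K,K')$ is the minimum number of $\Delta$-moves needed to deform a diagram of $K$ into a diagram of $K'$ (isotopies being free), and the $\Delta$-unknotting number is $u^{\Delta}(K)=d_G^{\Delta}(K,O)$, with $O$ the trivial knot. Conway's normal form $C(\alpha_1,\dots,\alpha_m)$ for integers $\alpha_1,\dots,\alpha_m$ (zero and negative entries allowed): take four horizontal strings numbered $1,2,3,4$ from top to bottom; join the left ends $1$–$2$ and $3$–$4$; going from left to right insert $|\alpha_1|$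 half-twists on strings $2,3$, then $|\alpha_2|$ half-twists on strings $1,2$, then $|\alpha_3|$ half-twists on strings $2,3$, and so on alternately; finally join the right ends $1$–$2$ and $3$–$4$ if $m$ is odd, and $2$–$3$ and $1$–$4$ if $m$ is even. For odd $i$ a right-handed half-twist is counted positive, for even $i$ a left-handed half-twist is counted positive (so the diagram is alternating if all $\alpha_i>0$). Equivalently $C(\alpha_1,\dots,\alpha_m)$ is the two-bridge knot or link with fraction $\alpha_1+\cfrac{1}{\alpha_2+\cfrac{1}{\ddots+\cfrac{1}{\alpha_m}}}$ (computed with $1/0=\infty$, $1/\infty=0$); for example $C(\alpha_1)$ is the torus knot or link $T(2,\alpha_1)$ and $C(2,2)$ is the figure-eight knot. *)

theory Defs
  imports "HOL-Analysis.Analysis"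
begin

section \<open>Knots in the 3-sphere\<close>

type_synonym space = "real \<times> real \<times> real"

definition S3 :: "(space \<times> real) set" where
  "S3 = sphere 0 1"

text \<open>Inverse stereographic projection, identifying \<open>\<real>\<^sup>3\<close> with \<open>S\<^sup>3\<close> minus a point.  Diagrams are
  drawn in \<open>\<real>\<^sup>3\<close>: the first coordinate runs to the right, the second one upwards, and the third one
  points towards the viewer.\<close>

definition to_S3 :: "space \<Rightarrow> space \<times> real" where
  "to_S3 p = ((2 / (1 + (norm p)\<^sup>2)) *\<^sub>R p, ((norm p)\<^sup>2 - 1) / (1 + (norm p)\<^sup>2))"

definition ambient_isotopic :: "(space \<times> real) set \<Rightarrow> (space \<times> real) set \<Rightarrow> bool" where
  "ambient_isotopic K L \<longleftrightarrow>
     (\<exists>h. homotopic_with_canon (\<lambda>f. \<exists>g. homeomorphism S3 S3 f g) S3 S3 id h \<and> h ` K = L)"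

definition smooth_closed_curve :: "(real \<Rightarrow> space \<times> real) \<Rightarrow> bool" where
  "smooth_closed_curve c \<longleftrightarrow>
     range c \<subseteq> S3 \<and> (\<forall>t. c (t + 1) = c t) \<and> inj_on c {0..<1} \<and>
     c C1_differentiable_on UNIV \<and> (\<forall>t. vector_derivative c (at t) \<noteq> 0)"

text \<open>Knots are unoriented and tame; tameness is ambient isotopy to a regular \<open>C\<^sup>1\<close> curve, so that
  corners are allowed.\<close>

definition knot :: "(space \<times> real) set \<Rightarrow> bool" where
  "knot K \<longleftrightarrow> K \<subseteq> S3 \<and> (\<exists>c. smooth_closed_curve c \<and> ambient_isotopic K (range c))"

definition unknot :: "(space \<times> real) set" where
  "unknot = to_S3 ` {(x, y, z). x\<^sup>2 + y\<^sup>2 = 1 \<and> z = 0}"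

definition trivial_knot :: "(space \<times> real) set \<Rightarrow> bool" where
  "trivial_knot K \<longleftrightarrow> knot K \<and> ambient_isotopic K unknot"


section \<open>Geometric braids\<close>

text \<open>Strings are numbered from top to bottom, string \<open>i\<close> having rest position \<open>(y, z) = (-i, 0)\<close>.
  A column of width 1 starting at \<open>x\<close> carries \<open>\<bar>a\<bar>\<close> half-twists on strings \<open>j\<close> and \<open>j + 1\<close>: these
  two strings rotate about the line through their midpoint by the total angle \<open>a \<pi>\<close>.
  For \<open>a > 0\<close> they trace right-handed helices, for \<open>a < 0\<close> left-handed ones, and for \<open>a = 0\<close> they
  are straight.\<close>

definition twist_column :: "nat \<Rightarrow> real \<Rightarrow> nat \<times> int \<Rightarrow> space set" where
  "twist_column N x = (\<lambda>(j, a).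
     {(x + t, - (real j + 1/2) + s * cos (of_int a * pi * t) / 2, s * sin (of_int a * pi * t) / 2)
        | s t. s \<in> {1, -1} \<and> t \<in> {0..1}} \<union>
     {(x + t, - real i, 0) | i t. i \<in> {1..N} - {j, j + 1} \<and> t \<in> {0..1}})"

text \<open>The geometric braid on \<open>N\<close> strings spelled by a word; the letter \<open>(j, a)\<close> stands for
  \<open>\<sigma>\<^sub>j\<^sup>a\<close>, where \<open>\<sigma>\<^sub>j\<close> is the right-handed half-twist of strings \<open>j\<close> and \<open>j + 1\<close>.\<close>

definition braid :: "nat \<Rightarrow> real \<Rightarrow> (nat \<times> int) list \<Rightarrow> space set" where
  "braid N x w = (\<Union>k<length w. twist_column N (x + real k) (w ! k))"


section \<open>Conway's normal form\<close>

text \<open>Entries are counted from 0 here, so that even positions carry the odd-numbered entries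
  \<open>\<alpha>\<^sub>1, \<alpha>\<^sub>3, \<dots>\<close> (right-handed twists of strings 2 and 3 positive) and odd positions the
  even-numbered ones (left-handed twists of strings 1 and 2 positive).\<close>

definition conway_word :: "int list \<Rightarrow> (nat \<times> int) list" where
  "conway_word as = map (\<lambda>i. if even i then (2, as ! i) else (1, - (as ! i))) [0..<length as]"

definition join_12_34 :: "real \<Rightarrow> space set" where
  "join_12_34 x = closed_segment (x, -1, 0) (x, -2, 0) \<union> closed_segment (x, -3, 0) (x, -4, 0)"

definition join_23_14 :: "real \<Rightarrow> space set" where
  "join_23_14 x = closed_segment (x, -2, 0) (x, -3, 0) \<union>
     (closed_segment (x, -1, 0) (x + 1, -1, 0) \<union> closed_segment (x + 1, -1, 0) (x + 1, -4, 0) \<union>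
      closed_segment (x + 1, -4, 0) (x, -4, 0))"

definition conway_diagram :: "int list \<Rightarrow> space set" where
  "conway_diagram as =
     join_12_34 0 \<union> braid 4 0 (conway_word as) \<union>
     (if odd (length as) then join_12_34 (real (length as)) else join_23_14 (real (length as)))"

definition conway :: "int list \<Rightarrow> (space \<times> real) set" where
  "conway as = to_S3 ` conway_diagram as"

text \<open>Two-bridge knots are the knots with a Conway normal form; this includes the trivial knot
  \<open>C(1)\<close>.\<close>

definition two_bridge_knot :: "(space \<times> real) set \<Rightarrow> bool" where
  "two_bridge_knot K \<longleftrightarrow> knot K \<and> (\<exists>as. ambient_isotopic K (conway as))"


section \<open>The Delta-move\<close>

text \<open>The disk of the move is the rectangle below in the plane of the first two coordinates; the set
  is the part of \<open>\<real>\<^sup>3\<close> projecting to it.\<close>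

definition over_disk :: "real \<Rightarrow> space set" where
  "over_disk x = {x..x + 3} \<times> {-7/2..-1/2} \<times> UNIV"

definition delta_tangles :: "real \<Rightarrow> (space set \<times> space set) set" where
  "delta_tangles x =
     {(braid 3 x [(1, e), (2, -e), (1, e)], braid 3 x [(2, e), (1, -e), (2, e)]) | e. e \<in> {1, -1}}"

definition delta_local :: "space set \<Rightarrow> space set \<Rightarrow> bool" where
  "delta_local D D' \<longleftrightarrow>
     (\<exists>x. D - over_disk x = D' - over_disk x \<and>
        (D \<inter> over_disk x, D' \<inter> over_disk x) \<in> delta_tangles x \<union> (delta_tangles x)\<inverse>)"

text \<open>Since \<open>K\<close> and \<open>K'\<close> may be isotoped freely, it is no restriction that the disk of the move has
  a standard shape, nor does it matter whether the parts of \<open>D\<close> and \<open>D'\<close> away from the disk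
  are in general position with respect to the projection.  The arcs may be oriented arbitrarily, so
  orientations play no role.\<close>

definition delta_move :: "(space \<times> real) set \<Rightarrow> (space \<times> real) set \<Rightarrow> bool" where
  "delta_move K K' \<longleftrightarrow> knot K \<and> knot K' \<and>
     (\<exists>D D'. ambient_isotopic K (to_S3 ` D) \<and> ambient_isotopic K' (to_S3 ` D') \<and> delta_local D D')"

definition delta_gordian_distance :: "(space \<times> real) set \<Rightarrow> (space \<times> real) set \<Rightarrow> enat" where
  "delta_gordian_distance K K' =
     (INF m \<in> {m. ((delta_move ^^ m) OO ambient_isotopic) K K'}. enat m)"

definition delta_unknotting_number :: "(space \<times> real) set \<Rightarrow> enat" where
  "delta_unknotting_number K = delta_gordian_distance K unknot"

end

theory Submission
  imports Defs
begin

text \<open>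
  Lower bound: distance 0 would make \<open>K\<close> ambient isotopic to the trivial knot.

  Upper bound: a single move on the diagram unknots \<open>K\<close>, for an algebraic reason.  All twists of a
  Conway normal form are on strings 1, 2, 3, so its twist region is a 3-braid next to a straight
  fourth string.  The entries \<open>-\<beta>\<^sub>2, \<dots>, -\<beta>\<^sub>n\<close> stand at positions of the same parity as
  \<open>\<beta>\<^sub>2, \<dots>, \<beta>\<^sub>n\<close>, hence give the inverse letters in reverse order, and \<open>1 - \<beta>\<^sub>1\<close> splits
  into a sixth \<open>1\<close> and \<open>-\<beta>\<^sub>1\<close>.  So the braid is \<open>\<sigma>\<^sub>2\<^sup>\<beta> W (\<sigma>\<^sub>k\<^sup>-\<^sup>s \<sigma>\<^sub>j\<^sup>s)\<^sup>3 W\<^sup>-\<^sup>1\<close> with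
  \<open>{j, k} = {1, 2}\<close> and a sign \<open>s\<close> depending on the parity of \<open>n\<close>.  The Delta-move replaces
  the three middle letters \<open>\<sigma>\<^sub>j\<^sup>s \<sigma>\<^sub>k\<^sup>-\<^sup>s \<sigma>\<^sub>j\<^sup>s\<close> of the cube by \<open>\<sigma>\<^sub>k\<^sup>s \<sigma>\<^sub>j\<^sup>-\<^sup>s \<sigma>\<^sub>k\<^sup>s\<close>, and the six
  letters become \<open>\<sigma>\<^sub>k\<^sup>-\<^sup>s (\<sigma>\<^sub>k\<^sup>s \<sigma>\<^sub>j\<^sup>-\<^sup>s \<sigma>\<^sub>k\<^sup>s) \<sigma>\<^sub>k\<^sup>-\<^sup>s \<sigma>\<^sub>j\<^sup>s\<close>, which cancel freely.  What remains is
  \<open>\<sigma>\<^sub>2\<^sup>\<beta>\<close>; since the sequence has even length, strings 2 and 3 are joined at the right end, and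
  twisting them next to that arc changes nothing up to isotopy.  The closure of the trivial braid is
  a planar curve.

  The isotopies come from homeomorphisms alone: by the Alexander trick
  (\<open>deformable_imp_ambient_isotopic\<close>) a compactly supported homeomorphism of \<open>\<real>\<^sup>3\<close>
  induces an ambient isotopy of \<open>S\<^sup>3\<close>.  A braid word acts on \<open>\<real>\<^sup>3\<close> by rotating, in each
  column, a disc around the two twisted strings.  These rotations are cut off radially, so powers of
  one generator compose exactly, not merely up to isotopy: a word that is freely trivial yields a
  homeomorphism that is the identity to the right of the braid (\<open>compact_homeo_braid_homeo\<close>).
  It carries straight strings to the geometric braid (\<open>braid_homeo_image\<close>), hence the closure of
  the trivial braid to the diagram after the move (\<open>braid_homeo_slotted_rectangle\<close>).  That planar
  curve bounds a rectangle with a slot; a tilt of the slot makes it star-shaped, and a radial map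
  makes it round (\<open>deformable_slotted_rectangle_circle\<close>).
\<close>

section \<open>Compactly supported homeomorphisms of Euclidean space\<close>

definition compact_homeo :: "('a::euclidean_space \<Rightarrow> 'a) \<Rightarrow> bool" where
  "compact_homeo h \<longleftrightarrow> (\<exists>g. homeomorphism UNIV UNIV h g) \<and> (\<exists>R. \<forall>v. norm v \<ge> R \<longrightarrow> h v = v)"

definition deformable :: "'a::euclidean_space set \<Rightarrow> 'a set \<Rightarrow> bool" where
  "deformable D E \<longleftrightarrow> (\<exists>h. compact_homeo h \<and> h ` D = E)"

text \<open>By invariance of domain the image is open; it is closed because the map is proper.  So an injective
  continuous map that is the identity outside a ball is onto, with continuous inverse.\<close>
lemma compact_homeoI:
  fixes h :: "'a::euclidean_space \<Rightarrow> 'a"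
  assumes cont: "continuous_on UNIV h" and inj: "inj h" and R: "\<And>v. norm v \<ge> R \<Longrightarrow> h v = v"
  shows "compact_homeo h"
proof -
  have "open (range h)"
    using invariance_of_domain[OF cont open_UNIV] inj by blast
  moreover have "closed (range h)"
  proof -
    have "range h = h ` cball 0 R \<union> - ball 0 R"
    proof (rule set_eqI)
      fix w show "w \<in> range h \<longleftrightarrow> w \<in> h ` cball 0 R \<union> - ball 0 R"
      proof
        assume "w \<in> range h"
        then obtain v where v: "w = h v" by blast
        show "w \<in> h ` cball 0 R \<union> - ball 0 R"
          using v R[of v] by (cases "norm v \<le> R") auto
      next
        assume "w \<in> h ` cball 0 R \<union> - ball 0 R"
        then show "w \<in> range h" using R[of w] by auto (metis rangeI)
      qed
    qed
    moreover have "compact (h ` cball 0 R)"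
      using cont by (intro compact_continuous_image) (auto intro: continuous_on_subset)
    ultimately show ?thesis
      by (simp add: closed_Un compact_imp_closed closed_Compl)
  qed
  ultimately have "range h = UNIV"
    using clopen by blast
  then obtain g where "homeomorphism UNIV UNIV h g"
    using invariance_of_domain_homeomorphism[OF open_UNIV cont _ inj] by auto
  then show ?thesis
    unfolding compact_homeo_def using R by blast
qed

lemma deformable_sym:
  assumes "deformable D E" shows "deformable E D"
proof -
  obtain h g R where h: "homeomorphism UNIV UNIV h g" "h ` D = E"
    and R: "\<And>v. norm v \<ge> R \<Longrightarrow> h v = v"
    using assms unfolding deformable_def compact_homeo_def by blast
  have gh: "g (h v) = v" for v using h(1) by (simp add: homeomorphism_def)
  have "compact_homeo g"
    unfolding compact_homeo_def using homeomorphism_symD[OF h(1)] R gh by metis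
  moreover have "g ` E = D"
    using h(2) gh by (auto simp: image_iff)
  ultimately show ?thesis unfolding deformable_def by blast
qed

lemma deformable_trans:
  assumes "deformable D E" "deformable E F" shows "deformable D F"
proof -
  obtain h g R where h: "homeomorphism UNIV UNIV h g" "h ` D = E"
    and R: "\<And>v. norm v \<ge> R \<Longrightarrow> h v = v"
    using assms unfolding deformable_def compact_homeo_def by blast
  obtain h' g' R' where h': "homeomorphism UNIV UNIV h' g'" "h' ` E = F"
    and R': "\<And>v. norm v \<ge> R' \<Longrightarrow> h' v = v"
    using assms unfolding deformable_def compact_homeo_def by blast
  have "norm v \<ge> max R R' \<Longrightarrow> (h' \<circ> h) v = v" for v
    using R R' by simp
  then have "compact_homeo (h' \<circ> h)"
    unfolding compact_homeo_def using homeomorphism_compose[OF h(1) h'(1)] by blast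
  then show ?thesis
    unfolding deformable_def using h(2) h'(2) by (auto simp: image_comp [symmetric] intro!: exI[of _ "h' \<circ> h"])
qed

text \<open>A translation is cut off so slowly (Lipschitz constant below 1 for the displacement) that injectivity
  survives.\<close>
lemma deformable_translation:
  fixes D :: "'a::euclidean_space set"
  assumes "bounded D"
  shows "deformable D ((+) c ` D)"
proof -
  obtain B where B: "\<And>v. v \<in> D \<Longrightarrow> norm v \<le> B"
    using assms by (auto simp: bounded_iff)
  define R where "R = max B 0 + norm c + 1"
  have R: "R > norm c" "R \<ge> B" "R > 0"
    unfolding R_def using norm_ge_zero[of c] by linarith+
  define f where "f v = max 0 (min 1 (2 - norm v / R))" for v :: 'a
  define h where "h v = v + f v *\<^sub>R c" for v
  have Lip: "\<bar>f v - f w\<bar> \<le> norm (v - w) / R" for v w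
  proof -
    have "\<bar>f v - f w\<bar> \<le> \<bar>norm v / R - norm w / R\<bar>"
      unfolding f_def by (auto simp: max_def min_def)
    also have "\<dots> = \<bar>norm v - norm w\<bar> / R"
      using R by (simp add: diff_divide_distrib[symmetric])
    also have "\<dots> \<le> norm (v - w) / R"
      using R by (intro divide_right_mono norm_triangle_ineq3) auto
    finally show ?thesis .
  qed
  have "compact_homeo h"
  proof (rule compact_homeoI[where R = "2 * R"])
    show "continuous_on UNIV h"
      unfolding h_def f_def using R by (intro continuous_intros) auto
    show "inj h"
    proof (rule injI)
      fix v w assume "h v = h w"
      then have eq: "v - w = (f w - f v) *\<^sub>R c"
        by (simp add: h_def algebra_simps)
      then have "norm (v - w) = \<bar>f v - f w\<bar> * norm c" by (simp add: abs_minus_commute)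
      also have "\<dots> \<le> norm (v - w) / R * norm c"
        by (intro mult_right_mono Lip) auto
      finally have "norm (v - w) * R \<le> norm (v - w) * norm c"
        using R by (simp add: field_simps)
      then have "norm (v - w) \<le> 0" using R(1)
        by (metis mult_le_cancel_left linorder_not_le)
      then show "v = w" by simp
    qed
    show "h v = v" if "norm v \<ge> 2 * R" for v
    proof -
      have "norm v / R \<ge> 2" using that R by (simp add: field_simps)
      then show ?thesis by (simp add: h_def f_def)
    qed
  qed
  moreover have "h v = c + v" if "v \<in> D" for v
  proof -
    have "norm v / R \<le> 1" using B[OF that] R by (simp add: field_simps)
    then show ?thesis by (simp add: h_def f_def)
  qed
  then have "h ` D = (+) c ` D" by (rule image_cong[OF refl])
  ultimately show ?thesis unfolding deformable_def by blast
qed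

text \<open>Along each ray, points are moved so that the gauge \<open>N / C\<close> becomes the norm near the level set,
  while the map is the identity far out.  As \<open>N / C\<close> is at most the norm, the two regimes can be
  joined by a maximum and a minimum of functions that increase along rays, so the new radius
  \<open>p\<close> increases as well.  The cone \<open>Z\<close> lets the same map serve for plane sections.\<close>
lemma deformable_gauge_to_sphere:
  fixes N :: "'a::euclidean_space \<Rightarrow> real"
  assumes cont: "continuous_on UNIV N"
    and hom: "\<And>t v. t > 0 \<Longrightarrow> N (t *\<^sub>R v) = t * N v"
    and low: "e > 0" "\<And>v. e * norm v \<le> N v"
    and up: "C > 0" "\<And>v. N v \<le> C * norm v"
    and cone: "\<And>t v. t > 0 \<Longrightarrow> v \<in> Z \<Longrightarrow> t *\<^sub>R v \<in> Z"
  shows "deformable {v \<in> Z. N v = 1} {v \<in> Z. norm v = 1 / C}"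
proof -
  \<comment> \<open>The level set of \<open>N\<close> lies in the ball of radius \<open>1 / e = B / 2\<close>, where \<open>2 * norm v - B\<close> is negative; the identity takes over at radius \<open>B\<close>.\<close>
  define B where "B = 2 / e"
  define p where "p v = min (norm v) (max (N v / C) (2 * norm v - B))" for v
  define h where "h v = (p v / norm v) *\<^sub>R v" for v
  have B: "B > 0" using low by (simp add: B_def)
  have Npos: "N v > 0" if "v \<noteq> 0" for v
    using low(2)[of v] low(1) that by (smt (verit) mult_pos_pos zero_less_norm_iff)
  have ppos: "p v > 0" if "v \<noteq> 0" for v
    using divide_pos_pos[OF Npos[OF that] up(1)] that by (simp add: p_def less_max_iff_disj)
  have p_mono: "p v < p (t *\<^sub>R v)" if "v \<noteq> 0" "t > 1" for v t
  proof -
    have n: "norm v < t * norm v" and N: "N v / C < t * N v / C"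
      using that Npos[OF that(1)] up(1) by (simp_all add: divide_strict_right_mono)
    have "p (t *\<^sub>R v) = min (t * norm v) (max (t * N v / C) (2 * (t * norm v) - B))"
      using that hom by (simp add: p_def)
    then show ?thesis using n N by (auto simp: p_def)
  qed
  have p_inj: "t = 1" if "v \<noteq> 0" "t > 0" "p (t *\<^sub>R v) = p v" for v t
  proof (rule ccontr)
    assume "t \<noteq> 1"
    then consider "t > 1" | "t < 1" by linarith
    then show False
    proof cases
      case 1 then show False using p_mono[OF that(1), of t] that by simp
    next
      case 2
      then have "p (t *\<^sub>R v) < p ((1 / t) *\<^sub>R (t *\<^sub>R v))"
        using that by (intro p_mono) (auto simp: field_simps)
      then show False using that by simp
    qed
  qed
  have norm_h: "norm (h v) = p v" for v
  proof (cases "v = 0")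
    case True
    have "N 0 = 0" using low(2)[of 0] up(2)[of 0] by simp
    then show ?thesis using True B by (simp add: h_def p_def)
  next
    case False then show ?thesis using ppos[OF False] by (simp add: h_def)
  qed
  have "compact_homeo h"
  proof (rule compact_homeoI[where R = B])
    have cp: "continuous_on UNIV p"
      unfolding p_def by (intro continuous_intros cont)  (use up in auto)
    have "isCont h v" for v
    proof (cases "v = 0")
      case True
      have "h 0 = 0" by (simp add: h_def)
      moreover have "(h \<longlongrightarrow> 0) (at 0)"
      proof (rule tendsto_norm_zero_cancel, rule tendsto_sandwich[of "\<lambda>_. 0" _ _ norm])
        show "\<forall>\<^sub>F x in at 0. norm (h x) \<le> norm x"
          unfolding norm_h by (simp add: p_def)
        show "(norm \<longlongrightarrow> 0) (at (0::'a))" using tendsto_norm_zero tendsto_ident_at by fastforce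
      qed auto
      ultimately show ?thesis using True by (simp add: isCont_def)
    next
      case False
      then show ?thesis
        unfolding h_def using cp by (intro continuous_intros) (auto simp: continuous_on_eq_continuous_at)
    qed
    then show "continuous_on UNIV h" by (simp add: continuous_at_imp_continuous_on)
    show "inj h"
    proof (rule injI)
      fix v w assume eq: "h v = h w"
      show "v = w"
      proof (cases "v = 0 \<or> w = 0")
        case True
        then show ?thesis using eq ppos norm_h by (metis less_irrefl norm_zero h_def scaleR_zero_right)
      next
        case False
        define t where "t = (p v / norm v) / (p w / norm w)"
        have t: "t > 0" using False ppos by (simp add: t_def)
        have w: "w = t *\<^sub>R v"
        proof -
          have c: "p w / norm w > 0" using False ppos by simp
          have "w = (1 / (p w / norm w)) *\<^sub>R ((p w / norm w) *\<^sub>R w)" using c False by auto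
          also have "\<dots> = (1 / (p w / norm w)) *\<^sub>R ((p v / norm v) *\<^sub>R v)"
            using eq by (simp only: h_def)
          also have "\<dots> = t *\<^sub>R v" by (simp add: t_def mult.commute)
          finally show ?thesis .
        qed
        have "p (t *\<^sub>R v) = p v" using w eq norm_h by metis
        then have "t = 1" using p_inj[OF _ t, of v] False by blast
        then show ?thesis using w by simp
      qed
    qed
    show "h v = v" if "norm v \<ge> B" for v
    proof -
      have "p v = norm v" using that by (auto simp: p_def)
      then show ?thesis using that B by (auto simp: h_def)
    qed
  qed
  moreover have "h ` {v \<in> Z. N v = 1} = {v \<in> Z. norm v = 1 / C}"
  proof -
    have p_level: "p v = 1 / C" if "N v = 1" for v
    proof -
      have "norm v \<le> 1 / e" "norm v \<ge> 1 / C"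
        using low(2)[of v] up(2)[of v] that low(1) up(1) by (simp_all add: field_simps)
      then have "2 * norm v - B \<le> 0" by (simp add: B_def field_simps)
      moreover have "1 / C > 0" using up by simp
      ultimately have "2 * norm v - B \<le> 1 / C" by linarith
      then show ?thesis using that \<open>norm v \<ge> 1 / C\<close> by (simp add: p_def)
    qed
    show ?thesis
    proof (intro subset_antisym subsetI)
      fix w assume "w \<in> h ` {v \<in> Z. N v = 1}"
      then obtain v where v: "v \<in> Z" "N v = 1" "w = h v" by blast
      then have "v \<noteq> 0" using low(2)[of 0] up(2)[of 0] by auto
      then have "w \<in> Z" unfolding v(3) h_def
        using ppos v by (intro cone) auto
      then show "w \<in> {v \<in> Z. norm v = 1 / C}"
        using v norm_h p_level by simp
    next
      fix w assume w: "w \<in> {v \<in> Z. norm v = 1 / C}"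
      then have w0: "w \<noteq> 0" using up by auto
      define v where "v = (1 / N w) *\<^sub>R w"
      have v: "v \<in> Z" "N v = 1"
        using w w0 Npos[OF w0] hom by (auto simp: v_def intro!: cone)
      have "h v = w"
        using p_level[OF v(2)] w Npos[OF w0] up(1) unfolding h_def v_def by simp
      then show "w \<in> h ` {v \<in> Z. N v = 1}" using v by blast
    qed
  qed
  ultimately show ?thesis unfolding deformable_def by blast
qed

text \<open>The bound \<open>N v \<le> C * norm v\<close> holds for some \<open>C \<ge> 1\<close> by compactness of the sphere.
  Both \<open>N\<close> and the norm satisfy it, so both level sets can be taken to the sphere of radius
  \<open>1 / C\<close>.\<close>
lemma deformable_gauge_to_unit_sphere:
  fixes N :: "'a::euclidean_space \<Rightarrow> real"
  assumes cont: "continuous_on UNIV N"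
    and hom: "\<And>t v. t > 0 \<Longrightarrow> N (t *\<^sub>R v) = t * N v"
    and pos: "\<And>v. v \<noteq> 0 \<Longrightarrow> N v > 0"
    and cone: "\<And>t v. t > 0 \<Longrightarrow> v \<in> Z \<Longrightarrow> t *\<^sub>R v \<in> Z"
  shows "deformable {v \<in> Z. N v = 1} {v \<in> Z. norm v = 1}"
proof -
  let ?S = "sphere (0::'a) 1"
  have S: "compact ?S" "continuous_on ?S N"
    using cont continuous_on_subset by auto
  obtain a where a: "a \<in> ?S" "\<And>v. v \<in> ?S \<Longrightarrow> N a \<le> N v"
    using continuous_attains_inf[OF S(1) _ S(2)] by auto
  obtain b where b: "b \<in> ?S" "\<And>v. v \<in> ?S \<Longrightarrow> N v \<le> N b"
    using continuous_attains_sup[OF S(1) _ S(2)] by auto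
  have a0: "N a > 0" using a(1) by (intro pos) auto
  have N0: "N 0 = 0" using hom[of 2 0] by simp
  have bd: "N a * norm v \<le> N v \<and> N v \<le> N b * norm v" for v
  proof (cases "v = 0")
    case False
    have "N v = norm v * N ((1 / norm v) *\<^sub>R v)"
      using False hom[of "norm v" "(1 / norm v) *\<^sub>R v"] by simp
    moreover have "(1 / norm v) *\<^sub>R v \<in> ?S" using False by simp
    ultimately show ?thesis
      using a(2)[of "(1 / norm v) *\<^sub>R v"] b(2)[of "(1 / norm v) *\<^sub>R v"]
      by (simp only: mult.commute[of _ "norm v"]) (simp add: mult_left_mono)
  qed (simp add: N0)
  define C where "C = max 1 (N b)"
  have C: "C > 0" "C \<ge> 1" "N b \<le> C" by (auto simp: C_def)
  have "deformable {v \<in> Z. N v = 1} {v \<in> Z. norm v = 1 / C}"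
    using cont hom a0 _ C(1) _ cone
  proof (rule deformable_gauge_to_sphere)
    show "N a * norm v \<le> N v" for v using bd by blast
    show "N v \<le> C * norm v" for v
      using bd[of v] C(3) by (meson mult_right_mono norm_ge_zero order_trans)
  qed
  moreover have "deformable {v \<in> Z. norm v = 1} {v \<in> Z. norm v = 1 / C}"
  proof (rule deformable_gauge_to_sphere[where e = 1])
    show "norm v \<le> C * norm v" for v :: 'a
      using C(2) by (metis mult_right_mono norm_ge_zero mult_1)
  qed (use C cone in \<open>auto intro!: continuous_intros\<close>)
  ultimately show ?thesis using deformable_sym deformable_trans by blast
qed

section \<open>Stereographic projection and the Alexander trick\<close>

abbreviation pole :: "space \<times> real" where "pole \<equiv> (0, 1)"

text \<open>Stereographic projection; at the pole the division by zero gives the value 0.\<close>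
definition from_S3 :: "space \<times> real \<Rightarrow> space" where
  "from_S3 q = (1 / (1 - snd q)) *\<^sub>R fst q"

lemma S3_iff: "q \<in> S3 \<longleftrightarrow> (norm (fst q))\<^sup>2 + (snd q)\<^sup>2 = 1"
  unfolding S3_def by (cases q) (auto simp: norm_Pair)

lemma snd_to_S3: "1 - snd (to_S3 p) = 2 / (1 + (norm p)\<^sup>2)"
proof -
  have "1 + (norm p)\<^sup>2 > 0" by (simp add: add_pos_nonneg)
  then show ?thesis by (simp add: to_S3_def field_simps)
qed

lemma snd_to_S3_less: "snd (to_S3 p) < 1"
proof -
  have "1 + (norm p)\<^sup>2 > 0" by (simp add: add_pos_nonneg)
  then have "1 - snd (to_S3 p) > 0" unfolding snd_to_S3 by simp
  then show ?thesis by simp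
qed

lemma to_S3_in_S3 [simp]: "to_S3 p \<in> S3"
proof -
  define n where "n = (norm p)\<^sup>2"
  have n: "1 + n > 0" unfolding n_def by (simp add: add_pos_nonneg)
  have "(norm (fst (to_S3 p)))\<^sup>2 + (snd (to_S3 p))\<^sup>2 = (2 / (1 + n))\<^sup>2 * n + ((n - 1) / (1 + n))\<^sup>2"
    by (simp add: to_S3_def n_def power_mult_distrib power_divide)
  also have "\<dots> = ((1 + n) / (1 + n))\<^sup>2"
    by (simp add: power_divide power2_eq_square add_divide_distrib[symmetric]) (simp add: algebra_simps)
  finally show ?thesis using n by (simp add: S3_iff)
qed

lemma from_to_S3 [simp]: "from_S3 (to_S3 p) = p"
proof -
  have "1 + (norm p)\<^sup>2 > 0" by (simp add: add_pos_nonneg)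
  then have "1 / (2 / (1 + (norm p)\<^sup>2)) * (2 / (1 + (norm p)\<^sup>2)) = 1" by simp
  then show ?thesis
    unfolding from_S3_def snd_to_S3 by (simp only: to_S3_def fst_conv scaleR_scaleR scaleR_one)
qed

lemma norm_from_S3:
  assumes "q \<in> S3" "snd q < 1"
  shows "(norm (from_S3 q))\<^sup>2 = (1 + snd q) / (1 - snd q)"
proof -
  have "(norm (fst q))\<^sup>2 = (1 + snd q) * (1 - snd q)"
    using assms(1) by (simp add: S3_iff algebra_simps power2_eq_square)
  then show ?thesis using assms(2)
    by (simp add: from_S3_def power_mult_distrib power_divide) (simp add: power2_eq_square)
qed

lemma to_from_S3:
  assumes "q \<in> S3" "snd q < 1"
  shows "to_S3 (from_S3 q) = q"
proof -
  have 1: "1 + (norm (from_S3 q))\<^sup>2 = 2 / (1 - snd q)"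
    using assms(2) unfolding norm_from_S3[OF assms] by (simp add: field_simps)
  have 2: "(norm (from_S3 q))\<^sup>2 - 1 = 2 * snd q / (1 - snd q)"
    using assms(2) unfolding norm_from_S3[OF assms] by (simp add: field_simps)
  show ?thesis
    unfolding to_S3_def 1 2 using assms(2) by (simp add: from_S3_def prod_eq_iff)
qed

lemma snd_le_1_S3: "q \<in> S3 \<Longrightarrow> snd q \<le> 1"
  unfolding S3_iff by (smt (verit) zero_le_power2 power2_le_imp_le one_power2)

lemma continuous_to_S3: "continuous_on UNIV to_S3"
proof -
  have "1 + (norm p)\<^sup>2 \<noteq> 0" for p :: space by (smt (verit) zero_le_power2)
  then show ?thesis unfolding to_S3_def by (intro continuous_intros) auto
qed

lemma ambient_isotopic_refl: "ambient_isotopic K K"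
proof -
  have "homotopic_with_canon (\<lambda>f. \<exists>g. homeomorphism S3 S3 f g) S3 S3 id id"
    using homeomorphism_ident[of S3] by (auto simp: homotopic_with_refl id_def)
  then show ?thesis unfolding ambient_isotopic_def by (intro exI[of _ id] conjI) simp_all
qed

text \<open>The isotopy of the Alexander trick: \<open>h\<close> conjugated by a homothety, which shrinks its support to
  the origin as \<open>s\<close> tends to 0.\<close>
definition alexander :: "('a::real_normed_vector \<Rightarrow> 'a) \<Rightarrow> real \<Rightarrow> 'a \<Rightarrow> 'a" where
  "alexander h s v = (if s = 0 then v else s *\<^sub>R h ((1 / s) *\<^sub>R v))"

text \<open>The displacement of \<open>h\<close> is bounded, and at time \<open>s\<close> it is scaled by \<open>s\<close>; this gives continuity
  at \<open>s = 0\<close>.\<close>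
lemma continuous_alexander:
  fixes h :: "'a::euclidean_space \<Rightarrow> 'a"
  assumes h: "continuous_on UNIV h" and R: "\<And>v. norm v \<ge> R \<Longrightarrow> h v = v"
  shows "continuous_on UNIV (\<lambda>(s, v). alexander h s v)"
proof -
  define u where "u w = h w - w" for w
  have u: "continuous_on UNIV u" unfolding u_def by (intro continuous_intros h)
  have "compact (u ` cball 0 R)"
    using u by (intro compact_continuous_image) (auto intro: continuous_on_subset)
  then obtain C where C: "\<And>w. w \<in> cball 0 R \<Longrightarrow> norm (u w) \<le> C"
    by (meson compact_imp_bounded bounded_iff imageI)
  have C': "norm (u w) \<le> \<bar>C\<bar>" for w
  proof (cases "norm w \<le> R")
    case True then show ?thesis using C[of w] by auto
  next
    case False then show ?thesis using R[of w] by (simp add: u_def)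
  qed
  \<comment> \<open>The displacement of the stage \<open>fst q\<close> at the point \<open>snd q\<close>; it vanishes at stage 0 whatever the value of \<open>u\<close>.\<close>
  define d where "d q = fst q *\<^sub>R u ((1 / fst q) *\<^sub>R snd q)" for q :: "real \<times> 'a"
  have "isCont d q" for q
  proof (cases "fst q = 0")
    case True
    have "(d \<longlongrightarrow> 0) (at q)"
    proof (rule tendsto_norm_zero_cancel, rule tendsto_sandwich[of "\<lambda>_. 0" _ _ "\<lambda>q. \<bar>fst q\<bar> * \<bar>C\<bar>"])
      show "\<forall>\<^sub>F x in at q. norm (d x) \<le> \<bar>fst x\<bar> * \<bar>C\<bar>"
        using C' by (simp add: d_def mult_left_mono)
      have "((\<lambda>q. \<bar>fst q\<bar> * \<bar>C\<bar>) \<longlongrightarrow> \<bar>fst q\<bar> * \<bar>C\<bar>) (at q)"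
        by (intro tendsto_intros)
      then show "((\<lambda>q. \<bar>fst q\<bar> * \<bar>C\<bar>) \<longlongrightarrow> 0) (at q)" using True by simp
    qed auto
    then show ?thesis using True by (simp add: isCont_def d_def)
  next
    case False
    have "isCont (\<lambda>q. (1 / fst q) *\<^sub>R snd q) q"
      using False by (intro continuous_intros) auto
    moreover have "isCont u x" for x using u by (simp add: continuous_on_eq_continuous_at)
    ultimately have "isCont (\<lambda>q. u ((1 / fst q) *\<^sub>R snd q)) q"
      by (rule isCont_o2)
    then show ?thesis unfolding d_def by (intro continuous_scaleR continuous_intros)
  qed
  then have "continuous_on UNIV d" by (simp add: continuous_at_imp_continuous_on)
  then have "continuous_on UNIV (\<lambda>q. snd q + d q)"
    by (intro continuous_on_add continuous_on_snd continuous_on_id)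
  moreover have "(\<lambda>q. snd q + d q) = (\<lambda>(s, v). alexander h s v)"
    by (auto simp: fun_eq_iff alexander_def d_def u_def scaleR_diff_right)
  ultimately show ?thesis by (simp only:)
qed

lemma alexander_far:
  assumes R: "\<And>v. norm v \<ge> R \<Longrightarrow> h v = v" and s: "0 \<le> s" "s \<le> 1" and v: "norm v \<ge> R" "R \<ge> 0"
  shows "alexander h s v = v"
proof (cases "s = 0")
  case False
  have "norm ((1 / s) *\<^sub>R v) \<ge> norm v"
    using s False by (simp add: field_simps mult_left_le_one_le)
  then show ?thesis using R[of "(1 / s) *\<^sub>R v"] v False by (simp add: alexander_def)
qed (simp add: alexander_def)

lemma alexander_bij:
  assumes "bij h" shows "bij (alexander h s)"
proof (cases "s = 0")
  case True then show ?thesis by (simp add: alexander_def[abs_def] bij_def inj_on_def)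
next
  case False
  have "alexander h s = (\<lambda>v. s *\<^sub>R v) \<circ> h \<circ> (\<lambda>v. (1 / s) *\<^sub>R v)"
    using False by (auto simp: alexander_def fun_eq_iff)
  moreover have "bij (\<lambda>v::'a. c *\<^sub>R v)" if "c \<noteq> 0" for c :: real
    using that by (intro bijI injI) (auto intro!: surjI[of _ "\<lambda>v. (1 / c) *\<^sub>R v"])
  ultimately show ?thesis using False assms by (auto intro!: bij_comp)
qed

text \<open>The Alexander trick, transported to \<open>S\<^sup>3\<close>.  All stages of the isotopy have their support in one
  ball, so near the pole they are the identity and extend continuously over it.\<close>
lemma deformable_imp_ambient_isotopic:
  assumes "deformable D E"
  shows "ambient_isotopic (to_S3 ` D) (to_S3 ` E)"
proof -
  obtain h g R0 where hg: "homeomorphism UNIV UNIV h g" and DE: "h ` D = E"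
    and R0: "\<And>v. norm v \<ge> R0 \<Longrightarrow> h v = v"
    using assms unfolding deformable_def compact_homeo_def by blast
  define R where "R = max R0 0"
  have R: "\<And>v. norm v \<ge> R \<Longrightarrow> h v = v" and R_nn: "R \<ge> 0" using R0 by (auto simp: R_def)
  have "inj h" using homeomorphism_apply1[OF hg] by (intro inj_on_inverseI[where g = g]) simp
  then have h: "continuous_on UNIV h" "bij h"
    using homeomorphism_image1[OF hg] homeomorphism_cont1[OF hg] by (simp_all add: bij_def)
  let ?A = "alexander h"
  have A_far: "?A s v = v" if "0 \<le> s" "s \<le> 1" "norm v \<ge> R" for s v
    using alexander_far[of R h s v] R R_nn that by blast
  have A_cont: "continuous_on UNIV (\<lambda>(s, v). ?A s v)"
    using continuous_alexander[of h R] h(1) R by blast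
  \<comment> \<open>The height on \<open>S\<^sup>3\<close> of the sphere of radius \<open>R\<close>.\<close>
  define c where "c = (R\<^sup>2 - 1) / (R\<^sup>2 + 1)"
  have R2: "R\<^sup>2 + 1 > 0" by (smt (verit) zero_le_power2)
  have c1: "c < 1" using R2 by (simp add: c_def field_simps)
  have far: "norm (from_S3 q) \<ge> R" if "q \<in> S3" "snd q < 1" "snd q \<ge> c" for q
  proof -
    have "R\<^sup>2 - 1 \<le> snd q * (R\<^sup>2 + 1)"
      using that(3) R2 by (simp add: c_def pos_divide_le_eq)
    then have "R\<^sup>2 * (1 - snd q) \<le> 1 + snd q" by (simp add: algebra_simps)
    then have "R\<^sup>2 \<le> (norm (from_S3 q))\<^sup>2"
      using that(2) unfolding norm_from_S3[OF that(1,2)] by (simp add: pos_le_divide_eq)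
    then show ?thesis by (rule power2_le_imp_le) simp
  qed
  define G where "G = (\<lambda>x. if snd (snd x) \<le> c then to_S3 (?A (fst x) (from_S3 (snd x))) else snd x)"
  have G_finite: "G (s, q) = to_S3 (?A s (from_S3 q))"
    if "0 \<le> s" "s \<le> 1" "q \<in> S3" "snd q < 1" for s q
  proof (cases "snd q \<le> c")
    case False
    then have "?A s (from_S3 q) = from_S3 q"
      using that by (intro A_far far) auto
    then show ?thesis using False that by (simp add: G_def to_from_S3)
  qed (simp add: G_def)
  have G_to: "G (s, to_S3 p) = to_S3 (?A s p)" if "0 \<le> s" "s \<le> 1" for s p
    using G_finite[of s "to_S3 p"] that snd_to_S3_less by simp
  have G_pole: "G (s, q) = q" if "\<not> snd q < 1" for s q
    using that c1 by (simp add: G_def)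
  have G_S3: "G (s, q) \<in> S3" if "q \<in> S3" for s q
    using that by (simp add: G_def)
  let ?X = "{0..1::real} \<times> S3"
  let ?L = "{x \<in> ?X. snd (snd x) \<le> c}" and ?U = "{x \<in> ?X. c \<le> snd (snd x)}"
  have contG: "continuous_on ?X G"
  proof -
    have "closed ?X" unfolding S3_def by (intro closed_Times) auto
    have Lclosed: "closed ?L" 
    proof -
      have "?L = ?X \<inter> {x. snd (snd x) \<le> c}" by auto
      then show ?thesis using \<open>closed ?X\<close>
        by (auto intro!: closed_Int closed_Collect_le continuous_intros)
    qed
    have Uclosed: "closed ?U" 
    proof -
      have "?U = ?X \<inter> {x. c \<le> snd (snd x)}" by auto
      then show ?thesis using \<open>closed ?X\<close>
        by (auto intro!: closed_Int closed_Collect_le continuous_intros)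
    qed
    have contL: "continuous_on ?L (\<lambda>x. to_S3 (?A (fst x) (from_S3 (snd x))))"
    proof -
      have 1: "continuous_on ?L (\<lambda>x. (fst x, from_S3 (snd x)))"
        unfolding from_S3_def using c1 by (intro continuous_intros) auto
      have "continuous_on ?L (\<lambda>x. (\<lambda>(s, v). ?A s v) (fst x, from_S3 (snd x)))"
        by (rule continuous_on_compose2[OF A_cont 1]) auto
      then have 2: "continuous_on ?L (\<lambda>x. ?A (fst x) (from_S3 (snd x)))" by simp
      show ?thesis
        by (rule continuous_on_compose2[OF continuous_to_S3 2]) auto
    qed
    have "continuous_on (?L \<union> ?U) G"
      unfolding G_def
    proof (rule continuous_on_cases[OF Lclosed Uclosed contL])
      show "continuous_on ?U snd" by (intro continuous_intros)
      show "\<forall>x. x \<in> ?L \<and> \<not> snd (snd x) \<le> c \<or> x \<in> ?U \<and> snd (snd x) \<le> c \<longrightarrow>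
          to_S3 (?A (fst x) (from_S3 (snd x))) = snd x"
      proof (intro allI impI)
        fix x assume "x \<in> ?L \<and> \<not> snd (snd x) \<le> c \<or> x \<in> ?U \<and> snd (snd x) \<le> c"
        then have x: "x \<in> ?X" "snd (snd x) = c" by auto
        then have "?A (fst x) (from_S3 (snd x)) = from_S3 (snd x)"
          using c1 by (intro A_far far) auto
        then show "to_S3 (?A (fst x) (from_S3 (snd x))) = snd x"
          using x c1 by (simp add: to_from_S3 mem_Times_iff)
      qed
    qed
    moreover have "?L \<union> ?U = ?X" by auto
    ultimately show ?thesis by simp
  qed
  have homeo: "\<exists>g. homeomorphism S3 S3 (\<lambda>q. G (s, q)) g" if s: "0 \<le> s" "s \<le> 1" for s
  proof (rule homeomorphism_compact)
    show "compact S3" by (simp add: S3_def)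
    show "continuous_on S3 (\<lambda>q. G (s, q))"
      by (rule continuous_on_compose2[OF contG]) (use s in \<open>auto intro!: continuous_intros\<close>)
    have bij: "bij (?A s)" by (rule alexander_bij[OF h(2)])
    have cases: "q = pole \<or> (\<exists>p. q = to_S3 p)" if "q \<in> S3" for q
    proof (cases "snd q < 1")
      case True then show ?thesis using to_from_S3[OF that] by metis
    next
      case False
      then have "snd q = 1" using snd_le_1_S3[OF that] by simp
      then show ?thesis using that by (cases q) (simp add: S3_iff)
    qed
    have Gp: "G (s, pole) = pole" by (rule G_pole) simp
    show "(\<lambda>q. G (s, q)) ` S3 = S3"
    proof (intro subset_antisym subsetI)
      fix q assume "q \<in> (\<lambda>q. G (s, q)) ` S3" then show "q \<in> S3" using G_S3 by auto
    next
      fix q assume q: "q \<in> S3"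
      from cases[OF q] show "q \<in> (\<lambda>q. G (s, q)) ` S3"
      proof
        assume "q = pole" then show ?thesis using q Gp by force
      next
        assume "\<exists>p. q = to_S3 p"
        then obtain p where p: "q = to_S3 p" by blast
        obtain p' where "?A s p' = p" using bij by (metis bij_pointE)
        then have "G (s, to_S3 p') = q" using p G_to[OF s] by simp
        then show ?thesis by (metis image_eqI to_S3_in_S3)
      qed
    qed
    show "inj_on (\<lambda>q. G (s, q)) S3"
    proof (rule inj_onI)
      fix q q' assume q: "q \<in> S3" "q' \<in> S3" and eq: "G (s, q) = G (s, q')"
      have ne: "G (s, to_S3 p) \<noteq> pole" for p
        using G_to[OF s, of p] snd_to_S3_less[of "?A s p"] by (metis less_irrefl snd_conv)
      have inj: "p = p'" if "G (s, to_S3 p) = G (s, to_S3 p')" for p p'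
        using that G_to[OF s] bij by (metis from_to_S3 bij_pointE)
      show "q = q'"
        using cases[OF q(1)] cases[OF q(2)] eq ne inj Gp by metis
    qed
  qed
  have "homotopic_with_canon (\<lambda>f. \<exists>g. homeomorphism S3 S3 f g) S3 S3 id (\<lambda>q. G (1, q))"
  proof (subst homotopic_with)
    fix f k :: "space \<times> real \<Rightarrow> space \<times> real"
    assume "\<And>x. x \<in> topspace (top_of_set S3) \<Longrightarrow> f x = k x"
    then have fk: "f x = k x" if "x \<in> S3" for x using that by simp
    have "homeomorphism S3 S3 f g \<longleftrightarrow> homeomorphism S3 S3 k g" for g
      using homeomorphism_cong[of S3 S3 f g S3 S3 k g] homeomorphism_cong[of S3 S3 k g S3 S3 f g]
      using fk by metis
    then show "(\<exists>g. homeomorphism S3 S3 f g) \<longleftrightarrow> (\<exists>g. homeomorphism S3 S3 k g)"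
      by simp
  next
    have "continuous_map (prod_topology (top_of_set {0..1}) (top_of_set S3)) (top_of_set S3) G"
      using contG G_S3 by (auto simp: continuous_map_iff_continuous2 image_subset_iff simp flip: subtopology_Times euclidean_product_topology)
    moreover have "G (0, q) = id q" if "q \<in> S3" for q
      using that by (auto simp: G_def alexander_def to_from_S3 c1 order.strict_trans1)
    ultimately have "continuous_map (prod_topology (top_of_set {0..1::real}) (top_of_set S3)) (top_of_set S3) G \<and>
        (\<forall>x\<in>topspace (top_of_set S3). G (0, x) = id x) \<and>
        (\<forall>x\<in>topspace (top_of_set S3). G (1, x) = G (1, x)) \<and>
        (\<forall>t\<in>{0..1}. \<exists>g. homeomorphism S3 S3 (\<lambda>x. G (t, x)) g)"
      using homeo by (simp del: split_paired_All)
    then show "\<exists>k. continuous_map (prod_topology (top_of_set {0..1::real}) (top_of_set S3)) (top_of_set S3) k \<and>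
        (\<forall>x\<in>topspace (top_of_set S3). k (0, x) = id x) \<and>
        (\<forall>x\<in>topspace (top_of_set S3). k (1, x) = G (1, x)) \<and>
        (\<forall>t\<in>{0..1}. \<exists>g. homeomorphism S3 S3 (\<lambda>x. k (t, x)) g)"
      by (rule exI[of _ G])
  qed
  moreover have "(\<lambda>q. G (1, q)) ` to_S3 ` D = to_S3 ` E"
    unfolding DE[symmetric] image_image by (simp add: G_to alexander_def)
  ultimately show ?thesis unfolding ambient_isotopic_def by blast
qed

section \<open>Straightening geometric braids\<close>

definition bump :: "real \<Rightarrow> real" where
  "bump r = max 0 (min 1 (2 - 2 * r))"

text \<open>Rotation about the midpoint of strings \<open>j\<close> and \<open>j + 1\<close> by the angle \<open>\<phi>\<close> on the disc of radius
  \<open>1/2\<close>, which just contains the two strings, damped to the identity at radius 1, before it reaches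
  any other string.\<close>
definition swirl :: "nat \<Rightarrow> real \<Rightarrow> real \<times> real \<Rightarrow> real \<times> real" where
  "swirl j \<phi> = (\<lambda>(y, z). let u = y + (real j + 1/2); \<theta> = \<phi> * bump (norm (u, z))
     in (- (real j + 1/2) + u * cos \<theta> - z * sin \<theta>, u * sin \<theta> + z * cos \<theta>))"

lemma rotation_radius:
  "(u * cos t - z * sin t)\<^sup>2 + (u * sin t + z * cos t)\<^sup>2 = u\<^sup>2 + (z::real)\<^sup>2"
proof -
  have "(u * cos t - z * sin t)\<^sup>2 + (u * sin t + z * cos t)\<^sup>2 = (u\<^sup>2 + z\<^sup>2) * ((sin t)\<^sup>2 + (cos t)\<^sup>2)"
    by algebra
  then show ?thesis by simp
qed

text \<open>The damping depends on the radius only, and rotations preserve the radius.\<close>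
lemma swirl_add: "swirl j \<phi> (swirl j \<psi> p) = swirl j (\<phi> + \<psi>) p"
proof -
  obtain y z where p: "p = (y, z)" by force
  define u where "u = y + (real j + 1/2)"
  define r where "r = norm (u, z)"
  define t where "t = \<psi> * bump r"
  have 1: "swirl j \<psi> p = (- (real j + 1/2) + (u * cos t - z * sin t), u * sin t + z * cos t)"
    by (simp add: p swirl_def Let_def u_def r_def t_def)
  have r: "norm (u * cos t - z * sin t, u * sin t + z * cos t) = r"
    by (simp add: norm_Pair rotation_radius r_def)
  have r': "norm (- (real j + 1/2) + (u * cos t - z * sin t) + (real j + 1/2), u * sin t + z * cos t) = r"
    using r by simp
  define s where "s = \<phi> * bump r"
  have 2: "swirl j \<phi> (swirl j \<psi> p) = (- (real j + 1/2) + ((u * cos t - z * sin t) * cos s - (u * sin t + z * cos t) * sin s),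
     (u * cos t - z * sin t) * sin s + (u * sin t + z * cos t) * cos s)"
    unfolding 1 by (simp only: swirl_def Let_def case_prod_conv r' s_def) simp
  have 3: "swirl j (\<phi> + \<psi>) p = (- (real j + 1/2) + (u * cos (s + t) - z * sin (s + t)), u * sin (s + t) + z * cos (s + t))"
    by (simp add: p swirl_def Let_def u_def r_def t_def s_def distrib_right)
  show ?thesis unfolding 2 3 by (simp add: cos_add sin_add algebra_simps)
qed

lemma swirl_0 [simp]: "swirl j 0 = id"
  by (auto simp: swirl_def fun_eq_iff Let_def)

lemma swirl_far:
  assumes "norm (fst p + (real j + 1/2), snd p) \<ge> 1" shows "swirl j \<phi> p = p"
proof -
  have "bump (norm (fst p + (real j + 1/2), snd p)) = 0" using assms by (simp add: bump_def)
  then show ?thesis by (cases p) (simp add: swirl_def Let_def)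
qed

lemma swirl_near:
  assumes "\<bar>s\<bar> \<le> 1/2"
  shows "swirl j \<phi> (- (real j + 1/2) + s, 0) = (- (real j + 1/2) + s * cos \<phi>, s * sin \<phi>)"
proof -
  have "bump (norm (s, 0::real)) = 1" using assms by (simp add: bump_def norm_Pair)
  then show ?thesis by (simp add: swirl_def Let_def)
qed

lemma continuous_swirl:
  fixes S :: "'a::t2_space set"
  assumes "continuous_on S f" "continuous_on S g"
  shows "continuous_on S (\<lambda>v. swirl j (f v) (g v))"
  unfolding swirl_def Let_def case_prod_beta bump_def
  by (intro continuous_intros assms)

definition column_homeo :: "real \<Rightarrow> nat \<times> int \<Rightarrow> space \<Rightarrow> space" where
  "column_homeo x0 l v =
     (fst v, swirl (fst l) (of_int (snd l) * pi * max 0 (min 1 (fst v - x0))) (snd v))"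

text \<open>Leftmost columns act first: further to the right their rotation has been completed, and the
  later columns rotate the result.\<close>
fun braid_homeo :: "real \<Rightarrow> (nat \<times> int) list \<Rightarrow> space \<Rightarrow> space" where
  "braid_homeo x0 [] = id"
| "braid_homeo x0 (l # w) = braid_homeo (x0 + 1) w \<circ> column_homeo x0 l"

text \<open>The planar homeomorphism by which \<open>braid_homeo\<close> acts to the right of all columns.\<close>
fun end_map :: "(nat \<times> int) list \<Rightarrow> real \<times> real \<Rightarrow> real \<times> real" where
  "end_map [] = id"
| "end_map (l # w) = end_map w \<circ> swirl (fst l) (of_int (snd l) * pi)"

lemma fst_braid_homeo [simp]: "fst (braid_homeo x0 w v) = fst v"
  by (induction w arbitrary: x0 v) (auto simp: column_homeo_def)

lemma braid_homeo_left: "fst v \<le> x0 \<Longrightarrow> braid_homeo x0 w v = v"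
  by (induction w arbitrary: x0 v) (auto simp: column_homeo_def max_def)

lemma braid_homeo_right:
  "fst v \<ge> x0 + real (length w) \<Longrightarrow> braid_homeo x0 w v = (fst v, end_map w (snd v))"
proof (induction w arbitrary: x0 v)
  case (Cons l w)
  have "column_homeo x0 l v = (fst v, swirl (fst l) (of_int (snd l) * pi) (snd v))"
    using Cons.prems by (simp add: column_homeo_def)
  then show ?case using Cons.IH[of "x0 + 1" "column_homeo x0 l v"] Cons.prems by simp
qed simp

lemma braid_homeo_append:
  "braid_homeo x0 (u @ w) = braid_homeo (x0 + real (length u)) w \<circ> braid_homeo x0 u"
  by (induction u arbitrary: x0) (simp_all add: comp_assoc add.assoc)

lemma end_map_append: "end_map (u @ w) = end_map w \<circ> end_map u"
  by (induction u) (simp_all add: comp_assoc)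

lemma continuous_braid_homeo: "continuous_on UNIV (braid_homeo x0 w)"
proof (induction w arbitrary: x0)
  case (Cons l w)
  have "continuous_on UNIV (column_homeo x0 l)"
    unfolding column_homeo_def by (intro continuous_intros continuous_swirl)
  then show ?case
    using continuous_on_compose2[OF Cons.IH] by (simp add: o_def)
qed simp

lemma inj_column_homeo: "inj (column_homeo x0 l)"
proof (rule injI)
  fix v w assume eq: "column_homeo x0 l v = column_homeo x0 l w"
  then have x: "fst v = fst w" by (simp add: column_homeo_def)
  define \<phi> where "\<phi> = of_int (snd l) * pi * max 0 (min 1 (fst v - x0))"
  have "swirl (fst l) \<phi> (snd v) = swirl (fst l) \<phi> (snd w)"
    using eq x by (simp add: column_homeo_def \<phi>_def)
  then have "swirl (fst l) (- \<phi>) (swirl (fst l) \<phi> (snd v)) = swirl (fst l) (- \<phi>) (swirl (fst l) \<phi> (snd w))"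
    by simp
  then show "v = w" using x by (simp add: swirl_add prod_eq_iff)
qed

lemma inj_braid_homeo: "inj (braid_homeo x0 w)"
  by (induction w arbitrary: x0) (auto intro: inj_compose inj_column_homeo)

text \<open>The support is bounded in the directions across the strings because swirls are, to the left by
  construction, and to the right by the hypothesis.\<close>
lemma compact_homeo_braid_homeo:
  assumes id: "end_map w = id"
  shows "compact_homeo (braid_homeo x0 w)"
proof -
  define M where "M = Max (insert 0 (fst ` set w))"
  have M: "fst l \<le> M" if "l \<in> set w" for l
    using that by (auto simp: M_def intro!: Max_ge)
  have far: "braid_homeo x1 u v = v" if "norm (snd v) \<ge> real M + 2" "set u \<subseteq> set w" for x1 u v
    using that
  proof (induction u arbitrary: x1 v)
    case (Cons l u)
    obtain y z where v: "snd v = (y, z)" by force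
    have "norm (snd v) \<le> norm (y + (real (fst l) + 1/2), z) + norm (- (real (fst l) + 1/2), 0::real)"
      using norm_triangle_ineq[of "(y + (real (fst l) + 1/2), z)" "(- (real (fst l) + 1/2), 0)"]
      by (simp add: v)
    moreover have "norm (- (real (fst l) + 1/2), 0::real) = real (fst l) + 1/2"
      by (simp add: norm_Pair)
    moreover have "real (fst l) \<le> real M" using Cons.prems M[of l] by simp
    ultimately have "norm (fst (snd v) + (real (fst l) + 1/2), snd (snd v)) \<ge> 1"
      using Cons.prems(1) unfolding v fst_conv snd_conv by linarith
    then have "column_homeo x1 l v = v" by (simp add: column_homeo_def swirl_far)
    then show ?case using Cons by simp
  qed simp
  define R where "R = \<bar>x0\<bar> + length w + real M + 2"
  show ?thesis
  proof (rule compact_homeoI[OF continuous_braid_homeo inj_braid_homeo, where R = R])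
    fix v :: space assume v: "norm v \<ge> R"
    have "norm v \<le> \<bar>fst v\<bar> + norm (snd v)"
      using norm_triangle_ineq[of "(fst v, 0)" "(0, snd v)"] by (simp add: norm_Pair)
    then consider "norm (snd v) \<ge> real M + 2" | "\<bar>fst v\<bar> \<ge> \<bar>x0\<bar> + length w"
      using v unfolding R_def by linarith
    then show "braid_homeo x0 w v = v"
    proof cases
      case 1 then show ?thesis using far by blast
    next
      case 2
      then consider "fst v \<le> x0" | "fst v \<ge> x0 + real (length w)" by linarith
      then show ?thesis using braid_homeo_left braid_homeo_right[of x0 w v] id by cases auto
    qed
  qed
qed

text \<open>The points where the strings of a geometric braid meet the planes between two columns.\<close>
definition rest :: "nat \<Rightarrow> (real \<times> real) set" where
  "rest N = {(- real i, 0) | i. i \<in> {1..N}}"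

definition letters_below :: "nat \<Rightarrow> (nat \<times> int) list \<Rightarrow> bool" where
  "letters_below N w \<longleftrightarrow> (\<forall>l\<in>set w. 1 \<le> fst l \<and> fst l < N)"

lemma rest_split:
  assumes "1 \<le> j" "j < N"
  shows "rest N = (\<lambda>s. (- (real j + 1/2) + s, 0)) ` {1/2, -1/2} \<union> {(- real i, 0) | i. i \<in> {1..N} - {j, j + 1}}"
proof -
  have "{1..N} = {j, j + 1} \<union> ({1..N} - {j, j + 1})" using assms by auto
  then have "rest N = {(- real i, 0) | i. i \<in> {j, j + 1}} \<union> {(- real i, 0) | i. i \<in> {1..N} - {j, j + 1}}"
    unfolding rest_def by blast
  moreover have "{(- real i, 0::real) | i. i \<in> {j, j + 1}} = {(- real j, 0), (- real (j + 1), 0)}"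
    by blast
  then have "{(- real i, 0::real) | i. i \<in> {j, j + 1}} = (\<lambda>s. (- (real j + 1/2) + s, 0)) ` {1/2, -1/2}"
    by simp
  ultimately show ?thesis by simp
qed

lemma swirl_rest:
  assumes "i \<notin> {j, j + 1}"
  shows "swirl j \<phi> (- real i, 0) = (- real i, 0)"
proof (rule swirl_far)
  have "i < j \<or> i > j + 1" using assms by auto
  then have "\<bar>- real i + (real j + 1/2)\<bar> \<ge> 1" by auto
  then show "1 \<le> norm (fst (- real i, 0::real) + (real j + 1 / 2), snd (- real i, 0::real))"
    by (simp add: norm_Pair)
qed

lemma swirl_image_rest:
  assumes "1 \<le> j" "j < N"
  shows "swirl j \<phi> ` rest N =
    (\<lambda>s. (- (real j + 1/2) + s * cos \<phi>, s * sin \<phi>)) ` {1/2, -1/2} \<union> {(- real i, 0) | i. i \<in> {1..N} - {j, j + 1}}"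
proof -
  have "swirl j \<phi> ` {(- real i, 0) | i. i \<in> {1..N} - {j, j + 1}} = (\<lambda>p. p) ` {(- real i, 0) | i. i \<in> {1..N} - {j, j + 1}}"
    by (rule image_cong[OF refl]) (auto simp: swirl_rest)
  moreover have "swirl j \<phi> ` (\<lambda>s. (- (real j + 1/2) + s, 0)) ` {1/2, -1/2} =
      (\<lambda>s. (- (real j + 1/2) + s * cos \<phi>, s * sin \<phi>)) ` {1/2, -1/2}"
    unfolding image_image by (rule image_cong[OF refl swirl_near]) auto
  ultimately show ?thesis unfolding rest_split[OF assms] image_Un by simp
qed

text \<open>A multiple of \<open>\<pi>\<close> fixes or exchanges the two strings.\<close>
lemma full_swirl_image_rest:
  assumes "1 \<le> j" "j < N"
  shows "swirl j (of_int a * pi) ` rest N = rest N"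
proof -
  have s: "sin (of_int a * pi) = 0" using sin_zero_iff_int2 by auto
  then have "\<bar>cos (of_int a * pi)\<bar> = 1" using sin_zero_abs_cos_one by blast
  then have "cos (of_int a * pi) = 1 \<or> cos (of_int a * pi) = -1" by linarith
  then have "(\<lambda>s. (- (real j + 1/2) + s * cos (of_int a * pi), s * sin (of_int a * pi))) ` {1/2, -1/2} =
      (\<lambda>s. (- (real j + 1/2) + s, 0)) ` {1/2, -1/2}"
    unfolding s by auto
  then show ?thesis unfolding swirl_image_rest[OF assms] by (simp only: rest_split[OF assms])
qed

lemma column_homeo_image:
  assumes "1 \<le> fst l" "fst l < N"
  shows "column_homeo x0 l ` ({x0..x0 + 1} \<times> rest N) = twist_column N x0 l"
proof -
  obtain j a where l: "l = (j, a)" by force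
  have j: "1 \<le> j" "j < N" using assms by (auto simp: l)
  have "column_homeo x0 l ` ({x0..x0 + 1} \<times> rest N) = (\<Union>t\<in>{0..1}. {x0 + t} \<times> swirl j (of_int a * pi * t) ` rest N)"
  proof (intro subset_antisym subsetI)
    fix v assume "v \<in> column_homeo x0 l ` ({x0..x0 + 1} \<times> rest N)"
    then obtain x p where x: "x \<in> {x0..x0 + 1}" "p \<in> rest N" "v = column_homeo x0 l (x, p)" by auto
    then have "v \<in> {x0 + (x - x0)} \<times> swirl j (of_int a * pi * (x - x0)) ` rest N"
      by (auto simp: column_homeo_def l)
    then show "v \<in> (\<Union>t\<in>{0..1}. {x0 + t} \<times> swirl j (of_int a * pi * t) ` rest N)"
      using x(1) by (intro UN_I[of "x - x0"]) auto
  next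
    fix v assume "v \<in> (\<Union>t\<in>{0..1}. {x0 + t} \<times> swirl j (of_int a * pi * t) ` rest N)"
    then obtain t p where t: "t \<in> {0..1}" "p \<in> rest N" "v = (x0 + t, swirl j (of_int a * pi * t) p)" by auto
    then have "v = column_homeo x0 l (x0 + t, p)" by (simp add: column_homeo_def l)
    then show "v \<in> column_homeo x0 l ` ({x0..x0 + 1} \<times> rest N)"
      using t by (intro image_eqI) auto
  qed
  also have "\<dots> = twist_column N x0 l"
    unfolding swirl_image_rest[OF j] l twist_column_def case_prod_conv
    by (intro subset_antisym subsetI) force+
  finally show ?thesis .
qed

lemma rest_subset_twist_column:
  assumes l: "1 \<le> fst l" "fst l < N"
  shows "{x0} \<times> rest N \<subseteq> twist_column N x0 l" "{x0 + 1} \<times> rest N \<subseteq> twist_column N x0 l"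
proof -
  let ?A = "{x0..x0 + 1} \<times> rest N"
  have "v \<in> twist_column N x0 l" if "v \<in> {x0} \<times> rest N" for v
  proof -
    have "column_homeo x0 l v = v" using that by (auto simp: column_homeo_def)
    moreover have "v \<in> ?A" using that by auto
    ultimately show ?thesis using column_homeo_image[OF l] by (metis image_eqI)
  qed
  then show "{x0} \<times> rest N \<subseteq> twist_column N x0 l" by blast
  have "v \<in> twist_column N x0 l" if "v \<in> {x0 + 1} \<times> rest N" for v
  proof -
    have "snd v \<in> swirl (fst l) (of_int (snd l) * pi) ` rest N"
      using that full_swirl_image_rest[OF l] by auto
    then obtain p where "p \<in> rest N" "snd v = swirl (fst l) (of_int (snd l) * pi) p" by blast
    then have "v = column_homeo x0 l (x0 + 1, p)" "(x0 + 1, p) \<in> ?A"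
      using that by (auto simp: column_homeo_def)
    then show ?thesis using column_homeo_image[OF l] by (metis image_eqI)
  qed
  then show "{x0 + 1} \<times> rest N \<subseteq> twist_column N x0 l" by blast
qed

lemma braid_Nil [simp]: "braid N x0 [] = {}"
  by (simp add: braid_def)

lemma braid_Cons: "braid N x0 (l # w) = twist_column N x0 l \<union> braid N (x0 + 1) w"
proof -
  have "{..<length (l # w)} = insert 0 (Suc ` {..<length w})" by (simp add: lessThan_Suc_eq_insert_0)
  then show ?thesis unfolding braid_def by (simp add: add.assoc)
qed

lemma braid_append: "braid N x0 (u @ w) = braid N x0 u \<union> braid N (x0 + real (length u)) w"
  by (induction u arbitrary: x0) (auto simp: braid_Cons add.assoc add.commute)

text \<open>Full swirls permute the resting points, so each column finds the strings at rest and twists them as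
  in \<open>twist_column\<close>.  The term \<open>{x0} \<times> rest N\<close> matters for the empty word only.\<close>
lemma braid_homeo_image:
  assumes "letters_below N w"
  shows "braid_homeo x0 w ` ({x0..x0 + length w} \<times> rest N) = {x0} \<times> rest N \<union> braid N x0 w"
  using assms
proof (induction w arbitrary: x0)
  case (Cons l w)
  have l: "1 \<le> fst l" "fst l < N" and w: "letters_below N w"
    using Cons.prems by (auto simp: letters_below_def)
  let ?A = "{x0..x0 + 1} \<times> rest N" and ?B = "{x0 + 1..x0 + 1 + length w} \<times> rest N"
  have AB: "{x0..x0 + length (l # w)} \<times> rest N = ?A \<union> ?B" by auto
  have A: "braid_homeo x0 (l # w) ` ?A = twist_column N x0 l"
  proof -
    have "braid_homeo x0 (l # w) ` ?A = column_homeo x0 l ` ?A"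
      by (rule image_cong[OF refl]) (auto simp: column_homeo_def braid_homeo_left)
    then show ?thesis using column_homeo_image[OF l] by simp
  qed
  have "column_homeo x0 l ` ?B = ?B"
  proof -
    have "column_homeo x0 l ` ?B = (\<lambda>v. (fst v, swirl (fst l) (of_int (snd l) * pi) (snd v))) ` ?B"
      by (rule image_cong[OF refl]) (auto simp: column_homeo_def)
    also have "\<dots> = {x0 + 1..x0 + 1 + length w} \<times> swirl (fst l) (of_int (snd l) * pi) ` rest N"
      by force
    finally show ?thesis using full_swirl_image_rest[OF l] by simp
  qed
  then have "braid_homeo x0 (l # w) ` ?B = braid_homeo (x0 + 1) w ` ?B"
    by (simp only: braid_homeo.simps image_comp[symmetric])
  then have B: "braid_homeo x0 (l # w) ` ?B = {x0 + 1} \<times> rest N \<union> braid N (x0 + 1) w"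
    by (simp only: Cons.IH[OF w])
  show ?case
    unfolding AB image_Un A B braid_Cons using rest_subset_twist_column[OF l, of x0] by blast
qed simp

lemma end_map_rest:
  assumes "letters_below N w" "p \<in> rest N" shows "end_map w p \<in> rest N"
  using assms
proof (induction w arbitrary: p)
  case (Cons l w)
  have "swirl (fst l) (of_int (snd l) * pi) p \<in> rest N"
    using Cons.prems full_swirl_image_rest[of "fst l" N "snd l"] by (auto simp: letters_below_def)
  then show ?case using Cons by (auto simp: letters_below_def)
qed simp

lemma braid_ends:
  fixes x0 :: real
  assumes w: "letters_below N w" and v: "v \<in> braid N x0 w"
  shows "x0 \<le> fst v" "fst v \<le> x0 + length w" "fst v = x0 \<Longrightarrow> snd v \<in> rest N"
    "fst v = x0 + length w \<Longrightarrow> snd v \<in> rest N"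
proof -
  have "v \<in> braid_homeo x0 w ` ({x0..x0 + length w} \<times> rest N)"
    using v braid_homeo_image[OF w, of x0] by blast
  then obtain q where "q \<in> {x0..x0 + length w} \<times> rest N" "v = braid_homeo x0 w q" by blast
  then obtain x p where x: "x0 \<le> x" "x \<le> x0 + length w" "p \<in> rest N" "v = braid_homeo x0 w (x, p)"
    by (cases q) auto
  then show "x0 \<le> fst v" "fst v \<le> x0 + length w" by auto
  show "snd v \<in> rest N" if "fst v = x0"
    using that x braid_homeo_left[of "(x, p)" x0 w] by simp
  show "snd v \<in> rest N" if "fst v = x0 + length w"
    using that x braid_homeo_right[of x0 w "(x, p)"] end_map_rest[OF w x(3)] by simp
qed

lemma rest_subset_braid_left:
  assumes w: "letters_below N w" "w \<noteq> []"
  shows "{x0} \<times> rest N \<subseteq> braid N x0 w"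
  using w rest_subset_twist_column(1)[of "hd w" N x0]
  by (cases w) (auto simp: braid_Cons letters_below_def)

lemma rest_subset_braid_right:
  fixes x0 :: real
  assumes w: "letters_below N w" "w \<noteq> []"
  shows "{x0 + length w} \<times> rest N \<subseteq> braid N x0 w"
proof -
  obtain u l where u: "w = u @ [l]" using w(2) by (metis rev_exhaust)
  then have "{x0 + length u + 1} \<times> rest N \<subseteq> twist_column N (x0 + length u) l"
    using w(1) by (intro rest_subset_twist_column(2)) (auto simp: letters_below_def)
  moreover have "braid N x0 w = braid N x0 u \<union> twist_column N (x0 + length u) l"
    by (simp add: u braid_append braid_Cons)
  moreover have "x0 + length w = x0 + length u + 1" by (simp add: u)
  ultimately show ?thesis by (simp only:) blast
qed

lemma braid_heights:
  assumes w: "letters_below N w" and v: "v \<in> braid N x0 w"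
  shows "- real N \<le> fst (snd v) \<and> fst (snd v) \<le> -1"
proof -
  obtain k where k: "k < length w" "v \<in> twist_column N (x0 + real k) (w ! k)"
    using v by (auto simp: braid_def)
  obtain j a where l: "w ! k = (j, a)" by force
  have j: "1 \<le> j" "j + 1 \<le> N" using w k(1) l nth_mem[OF k(1)] by (force simp: letters_below_def)+
  from k(2) consider s t where "s \<in> {1, -1}" "fst (snd v) = - (real j + 1/2) + s * cos (of_int a * pi * t) / 2"
    | i where "i \<in> {1..N}" "fst (snd v) = - real i"
    unfolding l twist_column_def by force
  then show ?thesis
  proof cases
    case 1
    have "\<bar>cos (of_int a * pi * t)\<bar> \<le> 1" by simp
    then have "\<bar>s * cos (of_int a * pi * t)\<bar> \<le> 1" using 1(1) by auto
    then show ?thesis using 1(2) j by linarith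
  qed auto
qed

section \<open>Closing a trivial braid\<close>

text \<open>The closure of the trivial braid on four strings: the boundary of the rectangle
  \<open>[0, L + 1] \<times> [-4, -1]\<close> minus the slot \<open>[0, L) \<times> (-3, -2)\<close>.\<close>
definition slotted_rectangle :: "real \<Rightarrow> space set" where
  "slotted_rectangle L = join_12_34 0 \<union> {0..L} \<times> rest 4 \<union> join_23_14 L"

lemma vertical_segment:
  "a \<ge> b \<Longrightarrow> closed_segment (x::real, a::real, 0::real) (x, b, 0) = {(x', y, z). x' = x \<and> b \<le> y \<and> y \<le> a \<and> z = 0}"
  by (auto simp: closed_segment_same_fst closed_segment_same_snd closed_segment_eq_real_ivl)

lemma horizontal_segment:
  "closed_segment (a, y, 0) (b, y::real, 0::real) = {(x, y', z). min a b \<le> x \<and> x \<le> max a b \<and> y' = y \<and> z = (0::real)}" for a b :: real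
  by (auto simp: closed_segment_same_snd closed_segment_eq_real_ivl)

lemma slotted_rectangle_iff:
  assumes "L > 0"
  shows "(x, y, z) \<in> slotted_rectangle L \<longleftrightarrow> z = 0 \<and>
    (x = 0 \<and> 1/2 \<le> \<bar>y + 5/2\<bar> \<and> \<bar>y + 5/2\<bar> \<le> 3/2 \<or>
     0 \<le> x \<and> x \<le> L + 1 \<and> \<bar>y + 5/2\<bar> = 3/2 \<or>
     0 \<le> x \<and> x \<le> L \<and> \<bar>y + 5/2\<bar> = 1/2 \<or>
     x = L \<and> \<bar>y + 5/2\<bar> \<le> 1/2 \<or>
     x = L + 1 \<and> \<bar>y + 5/2\<bar> \<le> 3/2)"
proof -
  have "{1..4::nat} = {1, 2, 3, 4}" by auto
  then have rest4: "rest 4 = {(-1, 0), (-2, 0), (-3, 0), (-4, 0)}"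
    by (auto simp: rest_def)
  have "(x, y, z) \<in> slotted_rectangle L \<longleftrightarrow> z = 0 \<and>
    (x = 0 \<and> (-2 \<le> y \<and> y \<le> -1 \<or> -4 \<le> y \<and> y \<le> -3) \<or>
     0 \<le> x \<and> x \<le> L \<and> (y = -1 \<or> y = -2 \<or> y = -3 \<or> y = -4) \<or>
     x = L \<and> -3 \<le> y \<and> y \<le> -2 \<or>
     L \<le> x \<and> x \<le> L + 1 \<and> (y = -1 \<or> y = -4) \<or>
     x = L + 1 \<and> -4 \<le> y \<and> y \<le> -1)"
    by (auto simp: slotted_rectangle_def join_12_34_def join_23_14_def vertical_segment horizontal_segment rest4)
  also have "\<dots> \<longleftrightarrow> z = 0 \<and>
    (x = 0 \<and> 1/2 \<le> \<bar>y + 5/2\<bar> \<and> \<bar>y + 5/2\<bar> \<le> 3/2 \<or>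
     0 \<le> x \<and> x \<le> L + 1 \<and> \<bar>y + 5/2\<bar> = 3/2 \<or>
     0 \<le> x \<and> x \<le> L \<and> \<bar>y + 5/2\<bar> = 1/2 \<or>
     x = L \<and> \<bar>y + 5/2\<bar> \<le> 1/2 \<or>
     x = L + 1 \<and> \<bar>y + 5/2\<bar> \<le> 3/2)"
    using assms by (smt (z3) field_sum_of_halves)
  finally show ?thesis .
qed

text \<open>The extra letter completes \<open>w\<close> to a trivial word.  It acts between \<open>x = L\<close> and
  \<open>x = L + 1\<close>, where the diagram has only the strings 1 and 4, which it does not move; and the arc
  at \<open>x = L\<close> joining strings 2 and 3 is mapped to itself by half-turns about its midpoint.  So
  the homeomorphism changes the trivial braid to \<open>w\<close> and keeps the closing arcs.\<close>
lemma braid_homeo_slotted_rectangle: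
  fixes w :: "(nat \<times> int) list" and c :: int
  assumes w: "letters_below 4 w" "w \<noteq> []" and id: "end_map (w @ [(2, c)]) = id"
  defines "L \<equiv> real (length w)"
  shows "braid_homeo 0 (w @ [(2, c)]) ` slotted_rectangle L = join_12_34 0 \<union> braid 4 0 w \<union> join_23_14 L"
proof -
  let ?H = "braid_homeo 0 (w @ [(2, c)])"
  have H: "?H v = column_homeo L (2, c) (braid_homeo 0 w v)" for v
    by (simp add: braid_homeo_append L_def)
  have H_left: "?H v = braid_homeo 0 w v" if "fst v \<le> L" for v
    using that by (simp add: H column_homeo_def prod_eq_iff)
  have "end_map w p = swirl 2 (- of_int c * pi) p" for p
  proof -
    have "swirl 2 (of_int c * pi) (end_map w p) = p"
      using fun_cong[OF id, of p] by (simp add: end_map_append)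
    then have "swirl 2 (- of_int c * pi) (swirl 2 (of_int c * pi) (end_map w p)) = swirl 2 (- of_int c * pi) p"
      by simp
    then show ?thesis by (simp add: swirl_add)
  qed
  \<comment> \<open>The word \<open>w\<close> acts like the inverse of the extra letter.\<close>
  then have end_w: "end_map w = swirl 2 (of_int (- c) * pi)" by auto
  have fixed: "?H v = v" if "fst (snd v) = -1 \<or> fst (snd v) = -4" "fst v \<ge> L" for v
  proof -
    have sw: "swirl 2 \<phi> (snd v) = snd v" for \<phi>
    proof (rule swirl_far)
      have "1 \<le> norm (fst (snd v) + (real 2 + 1/2))" using that(1) by auto
      also have "\<dots> \<le> norm (fst (snd v) + (real 2 + 1/2), snd (snd v))"
        by (rule norm_fst_le)
      finally show "1 \<le> norm (fst (snd v) + (real 2 + 1/2), snd (snd v))" .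
    qed
    have "braid_homeo 0 w v = v"
      using that(2) braid_homeo_right[of 0 w v] by (simp add: L_def end_w sw del: of_int_minus)
    then show ?thesis by (simp add: H column_homeo_def sw)
  qed
  have A: "?H ` join_12_34 0 = join_12_34 0"
  proof -
    have "fst v = 0" if "v \<in> join_12_34 0" for v
      using that by (auto simp: join_12_34_def vertical_segment)
    then have "?H ` join_12_34 0 = id ` join_12_34 0"
      by (intro image_cong[OF refl]) (simp add: braid_homeo_left)
    then show ?thesis by simp
  qed
  have B: "?H ` ({0..L} \<times> rest 4) = braid 4 0 w"
  proof -
    have "?H ` ({0..L} \<times> rest 4) = braid_homeo 0 w ` ({0..0 + real (length w)} \<times> rest 4)"
      by (rule image_cong) (auto simp: H_left L_def)
    then show ?thesis
      using braid_homeo_image[OF w(1), of 0] rest_subset_braid_left[OF w, of 0] by auto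
  qed
  let ?S = "closed_segment (L, -2, 0) (L, -3, 0) :: space set"
  let ?T = "closed_segment (L, -1, 0) (L + 1, -1, 0) \<union> closed_segment (L + 1, -1, 0) (L + 1, -4, 0) \<union>
      closed_segment (L + 1, -4, 0) (L, -4, 0) :: space set"
  have S: "?S = (\<lambda>s. (L, - (real 2 + 1/2) + s, 0)) ` {-1/2..1/2}"
  proof (intro subset_antisym subsetI)
    fix v assume "v \<in> ?S"
    then show "v \<in> (\<lambda>s. (L, - (real 2 + 1/2) + s, 0)) ` {-1/2..1/2}"
      by (intro image_eqI[of _ _ "fst (snd v) + 5/2"]) (auto simp: vertical_segment)
  qed (auto simp: vertical_segment)
  have C1: "?H ` ?S = ?S"
  proof -
    have s0: "sin (of_int (- c) * pi) = 0" using sin_zero_iff_int2 by blast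
    then have c1: "\<bar>cos (of_int (- c) * pi)\<bar> = 1" using sin_zero_abs_cos_one by blast
    have "?H (L, - (real 2 + 1/2) + s, 0) = (L, - (real 2 + 1/2) + s * cos (of_int (- c) * pi), 0)"
      if "s \<in> {-1/2..1/2}" for s
    proof -
      have "?H (L, - (real 2 + 1/2) + s, 0) = (L, end_map w (- (real 2 + 1/2) + s, 0))"
        using H_left[of "(L, - (real 2 + 1/2) + s, 0)"] braid_homeo_right[of 0 w "(L, - (real 2 + 1/2) + s, 0)"]
        by (simp add: L_def)
      moreover have "\<bar>s\<bar> \<le> 1/2" using that by auto
      ultimately show ?thesis unfolding end_w swirl_near[OF \<open>\<bar>s\<bar> \<le> 1/2\<close>] s0 by simp
    qed
    then have "?H ` ?S = (\<lambda>s. (L, - (real 2 + 1/2) + s * cos (of_int (- c) * pi), 0)) ` {-1/2..1/2}"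
      unfolding S image_image by (rule image_cong[OF refl])
    also have "\<dots> = (\<lambda>s. (L, - (real 2 + 1/2) + s, 0)) ` (\<lambda>s. s * cos (of_int (- c) * pi)) ` {-1/2..1/2}"
      by (simp add: image_image)
    also have "(\<lambda>s. s * cos (of_int (- c) * pi)) ` {-1/2..1/2} = {-1/2..1/2}"
    proof -
      have "cos (of_int (- c) * pi) = 1 \<or> cos (of_int (- c) * pi) = -1" using c1 by linarith
      then show ?thesis
      proof
        assume "cos (of_int (- c) * pi) = -1"
        then show ?thesis using image_uminus_atLeastAtMost[of "-1/2" "1/2::real"] by simp
      qed simp
    qed
    finally show ?thesis unfolding S .
  qed
  have C2: "?H ` ?T = ?T"
  proof -
    have "?H v = v" if "v \<in> ?T" for v
    proof -
      from that consider "fst (snd v) = -1 \<or> fst (snd v) = -4" "fst v \<ge> L" | "fst v = L + 1"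
        by (auto simp: vertical_segment horizontal_segment)
      then show ?thesis
      proof cases
        case 1 then show ?thesis by (rule fixed)
      next
        case 2
        then show ?thesis
          using braid_homeo_right[of 0 "w @ [(2, c)]" v] id by (simp add: L_def prod_eq_iff)
      qed
    qed
    then have "?H ` ?T = id ` ?T" by (intro image_cong[OF refl]) simp
    then show ?thesis by simp
  qed
  show ?thesis
    unfolding slotted_rectangle_def image_Un A B join_23_14_def[of L] using C1 C2 unfolding image_Un by simp
qed

section \<open>The slotted rectangle is unknotted\<close>

text \<open>An odd piecewise linear function with slopes \<open>2, -1, 0\<close> to the right of 0: the direction of
  the tilt, largest at the sides \<open>u = 1/2\<close> and \<open>u = -1/2\<close> of the slot and zero on the outer sides of
  the rectangle.\<close>
definition tent :: "real \<Rightarrow> real" where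
  "tent u = max (-1) (min 1 (2 * u)) - max 0 (min 1 (u - 1/2)) + max 0 (min 1 (- u - 1/2))"

lemma tent_simps:
  "\<bar>u\<bar> \<le> 1/2 \<Longrightarrow> tent u = 2 * u"
  "1/2 \<le> u \<Longrightarrow> u \<le> 3/2 \<Longrightarrow> tent u = 3/2 - u"
  "-3/2 \<le> u \<Longrightarrow> u \<le> -1/2 \<Longrightarrow> tent u = - 3/2 - u"
  "\<bar>u\<bar> \<ge> 3/2 \<Longrightarrow> tent u = 0"
  by (auto simp: tent_def)

lemma tent_slope: "u \<le> v \<Longrightarrow> tent v - tent u \<le> 2 * (v - u)"
  unfolding tent_def by (simp add: max_def min_def)

text \<open>For \<open>z = 0\<close> this grows linearly from 0 at \<open>x = 0\<close> to almost \<open>1/2\<close> at \<open>x = L\<close>, then drops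
  to 0 at \<open>x = L + 1\<close>.\<close>
definition tilt_amount :: "real \<Rightarrow> real \<Rightarrow> real \<Rightarrow> real" where
  "tilt_amount L x z = max 0 (min (2 * x) (2 * L * (L + 1 - x)) / (4 * L + 1) - \<bar>z\<bar>)"

text \<open>Pushes the sides of the slot together, the more the deeper.  Before, no point sees both sides of
  the slot from inside the region; afterwards both sides are visible from
  \<open>(L + 1/2, - 5/2)\<close>, because their extensions meet a little to the left of that point.\<close>
definition tilt :: "real \<Rightarrow> space \<Rightarrow> space" where
  "tilt L = (\<lambda>(x, y, z). (x, y - tilt_amount L x z * tent (y + 5/2), z))"

text \<open>The bound \<open>1/2\<close> makes the tilt injective, as \<open>tent\<close> has slope at most 2.\<close>
lemma tilt_amount_less:
  assumes "L \<ge> 1" shows "0 \<le> tilt_amount L x z" "tilt_amount L x z < 1/2"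
proof -
  show "0 \<le> tilt_amount L x z" by (simp add: tilt_amount_def)
  have "min (2 * x) (2 * L * (L + 1 - x)) \<le> 2 * L"
  proof (cases "x \<le> L")
    case False
    then have "2 * L * (L + 1 - x) \<le> 2 * L * 1" using assms by (intro mult_left_mono) auto
    then show ?thesis by simp
  qed simp
  then have "min (2 * x) (2 * L * (L + 1 - x)) / (4 * L + 1) \<le> 2 * L / (4 * L + 1)"
    using assms by (intro divide_right_mono) auto
  also have "\<dots> < 1/2" using assms by (simp add: field_simps)
  finally show "tilt_amount L x z < 1/2" unfolding tilt_amount_def max_less_iff_conj by linarith
qed

lemma compact_homeo_tilt:
  assumes L: "L \<ge> 1" shows "compact_homeo (tilt L)"
proof (rule compact_homeoI[where R = "L + 8"])
  show "continuous_on UNIV (tilt L)"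
    unfolding tilt_def tilt_amount_def tent_def case_prod_beta using L by (intro continuous_intros) auto
  show "inj (tilt L)"
  proof -
    have mono: "u - a * tent u < v - a * tent v" if "u < v" "0 \<le> a" "a < 1/2" for a u v
    proof -
      have "a * (tent v - tent u) \<le> a * (2 * (v - u))"
        using that tent_slope[of u v] by (intro mult_left_mono) auto
      also have "\<dots> = (2 * a) * (v - u)" by simp
      also have "\<dots> < 1 * (v - u)" using that by (intro mult_strict_right_mono) auto
      finally show ?thesis by (simp add: algebra_simps)
    qed
    have inj: "y = y'" if eq: "y - a * tent (y + 5/2) = y' - a * tent (y' + 5/2)" "0 \<le> a" "a < 1/2" for a y y'
    proof -
      have "\<not> y < y'" using mono[of "y + 5/2" "y' + 5/2" a] eq by linarith
      moreover have "\<not> y' < y" using mono[of "y' + 5/2" "y + 5/2" a] eq by linarith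
      ultimately show ?thesis by linarith
    qed
    show ?thesis
    proof (rule injI)
      fix v w assume eq: "tilt L v = tilt L w"
      obtain x y z x' y' z' where vw: "v = (x, y, z)" "w = (x', y', z')" by (metis prod_cases3)
      then have "x = x'" "z = z'" using eq by (auto simp: tilt_def)
      moreover from this have "y = y'"
        using eq tilt_amount_less[OF L, of x z] by (intro inj[of y "tilt_amount L x z" y']) (auto simp: tilt_def vw)
      ultimately show "v = w" by (simp add: vw)
    qed
  qed
  fix v :: space assume v: "norm v \<ge> L + 8"
  obtain x y z where xyz: "v = (x, y, z)" by (metis prod_cases3)
  have "norm v \<le> \<bar>x\<bar> + \<bar>y\<bar> + \<bar>z\<bar>"
    using norm_triangle_ineq[of "(x, 0, 0)" "(0, y, z)"] norm_triangle_ineq[of "(y, 0)" "(0, z)"]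
    by (simp add: xyz norm_Pair)
  then consider "x \<le> 0" | "x \<ge> L + 1" | "\<bar>z\<bar> \<ge> 1/2" | "\<bar>y\<bar> \<ge> 4"
    using v by linarith
  then show "tilt L v = v"
  proof cases
    case 1
    then have "min (2 * x) (2 * L * (L + 1 - x)) / (4 * L + 1) \<le> 0"
      using L by (intro divide_nonpos_pos) auto
    then show ?thesis by (simp add: xyz tilt_def tilt_amount_def)
  next
    case 2
    then have "2 * L * (L + 1 - x) \<le> 0" using L by (intro mult_nonneg_nonpos) auto
    then have "min (2 * x) (2 * L * (L + 1 - x)) / (4 * L + 1) \<le> 0"
      using L by (intro divide_nonpos_pos) auto
    then show ?thesis by (simp add: xyz tilt_def tilt_amount_def)
  next
    case 3
    have "tilt_amount L x 0 < 1/2" by (rule tilt_amount_less[OF L])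
    then have "tilt_amount L x z = 0" using 3 by (auto simp: tilt_amount_def)
    then show ?thesis by (simp add: xyz tilt_def)
  next
    case 4
    then have "3/2 \<le> \<bar>y + 5/2\<bar>" by linarith
    then have "tent (y + 5/2) = 0" by (rule tent_simps(4))
    then show ?thesis by (simp add: xyz tilt_def)
  qed
qed

text \<open>The gauge of the tilted region, centred at the origin.  The first three terms belong to the
  rectangle, the fourth extends the gauge to space, and the last one is at least 1
  exactly on the tilted slot, prolonged to the left:
  \<open>x \<le> - 1/2\<close> expresses its depth, and \<open>- 4 x - (8 L + 2) \<bar>y\<bar> \<ge> 1\<close> its two sides.\<close>
definition tilted_gauge :: "real \<Rightarrow> space \<Rightarrow> real" where
  "tilted_gauge L = (\<lambda>(x, y, z).
     max (- x / (L + 1/2)) (max (2 * x) (max (\<bar>y\<bar> / (3/2)) (max \<bar>z\<bar>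
       (min (- 2 * x) (- 4 * x - (8 * L + 2) * \<bar>y\<bar>))))))"

lemma tilted_gauge_simp: "tilted_gauge L (x, y, z) =
    max (- x / (L + 1/2)) (max (2 * x) (max (\<bar>y\<bar> / (3/2)) (max \<bar>z\<bar> (min (- 2 * x) (- 4 * x - (8 * L + 2) * \<bar>y\<bar>)))))"
  by (simp only: tilted_gauge_def case_prod_conv)

text \<open>The tilt keeps \<open>\<bar>u\<bar> = 3/2\<close>, moves \<open>\<bar>u\<bar> = 1/2\<close> to \<open>1/2 - a\<close>, and preserves the order in
  between.\<close>
lemma tilted_offset:
  assumes "0 \<le> a" "a < 1/2"
  shows "\<bar>u - a * tent u\<bar> \<le> 3/2 \<longleftrightarrow> \<bar>u\<bar> \<le> 3/2" "\<bar>u - a * tent u\<bar> = 3/2 \<longleftrightarrow> \<bar>u\<bar> = 3/2"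
    "\<bar>u - a * tent u\<bar> \<le> 1/2 - a \<longleftrightarrow> \<bar>u\<bar> \<le> 1/2" "\<bar>u - a * tent u\<bar> = 1/2 - a \<longleftrightarrow> \<bar>u\<bar> = 1/2"
proof -
  consider "\<bar>u\<bar> \<le> 1/2" | "1/2 < u" "u \<le> 3/2" | "-3/2 \<le> u" "u < -1/2" | "\<bar>u\<bar> > 3/2" by linarith
  then have "(\<bar>u\<bar> < 1/2 \<and> \<bar>u - a * tent u\<bar> < 1/2 - a) \<or> (\<bar>u\<bar> = 1/2 \<and> \<bar>u - a * tent u\<bar> = 1/2 - a) \<or>
     (1/2 < \<bar>u\<bar> \<and> \<bar>u\<bar> < 3/2 \<and> 1/2 - a < \<bar>u - a * tent u\<bar> \<and> \<bar>u - a * tent u\<bar> < 3/2) \<or>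
     (\<bar>u\<bar> \<ge> 3/2 \<and> \<bar>u - a * tent u\<bar> = \<bar>u\<bar>)"
  proof cases
    case 1
    have "u - a * tent u = (1 - 2 * a) * u" using 1 tent_simps(1) by (simp add: algebra_simps)
    then have abs: "\<bar>u - a * tent u\<bar> = (1 - 2 * a) * \<bar>u\<bar>" using assms by (simp add: abs_mult)
    show ?thesis
    proof (cases "\<bar>u\<bar> = 1/2")
      case True then show ?thesis using abs by (simp add: algebra_simps)
    next
      case False
      then have "(1 - 2 * a) * \<bar>u\<bar> < (1 - 2 * a) * (1/2)" using 1 assms by (intro mult_strict_left_mono) auto
      then show ?thesis using abs 1 False by (auto simp: algebra_simps)
    qed
  next
    case 2
    have t: "tent u = 3/2 - u" using 2 by (intro tent_simps) auto
    define p where "p = a * (3/2 - u)"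
    have "p \<ge> 0" "u = 3/2 \<longrightarrow> p = 0" using 2 assms by (auto simp: p_def)
    moreover have "u - p - (1/2 - a) = (1 + a) * (u - 1/2)" unfolding p_def by algebra
    then have "u - p > 1/2 - a" using 2 assms mult_pos_pos[of "1 + a" "u - 1/2"] by linarith
    ultimately show ?thesis using 2 assms unfolding t p_def[symmetric] by linarith
  next
    case 3
    have t: "tent u = - 3/2 - u" using 3 by (intro tent_simps) auto
    define p where "p = a * (- 3/2 - u)"
    have "a * (3/2 + u) \<ge> 0" using 3 assms by auto
    then have "p \<le> 0" "u = - 3/2 \<longrightarrow> p = 0" by (auto simp: p_def algebra_simps)
    moreover have "- u + p - (1/2 - a) = (1 + a) * (- u - 1/2)" unfolding p_def by algebra
    then have "- u + p > 1/2 - a" using 3 assms mult_pos_pos[of "1 + a" "- u - 1/2"] by linarith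
    ultimately show ?thesis using 3 assms unfolding t p_def[symmetric] by linarith
  next
    case 4
    then show ?thesis using tent_simps(4)[of u] by simp
  qed
  then show "\<bar>u - a * tent u\<bar> \<le> 3/2 \<longleftrightarrow> \<bar>u\<bar> \<le> 3/2" "\<bar>u - a * tent u\<bar> = 3/2 \<longleftrightarrow> \<bar>u\<bar> = 3/2"
    "\<bar>u - a * tent u\<bar> \<le> 1/2 - a \<longleftrightarrow> \<bar>u\<bar> \<le> 1/2" "\<bar>u - a * tent u\<bar> = 1/2 - a \<longleftrightarrow> \<bar>u\<bar> = 1/2"
    using assms by linarith+
qed

text \<open>For \<open>0 \<le> x \<le> L\<close> the side of the tilted slot has the offset \<open>1/2 - 2 x / (4 L + 1)\<close> from the
  centre line, and this is where the linear function in the last term of the gauge equals 1.\<close>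
lemma tilted_gauge_tilt:
  assumes L: "L \<ge> 1"
  shows "tilted_gauge L (x - (L + 1/2), y - tilt_amount L x 0 * tent (y + 5/2) + 5/2, 0) = 1 \<longleftrightarrow> (x, y, 0) \<in> slotted_rectangle L"
proof -
  define a u where "a = tilt_amount L x 0" and "u = y + 5/2"
  define w where "w = \<bar>u - a * tent u\<bar>"
  have a: "0 \<le> a" "a < 1/2" using tilt_amount_less[OF L] by (auto simp: a_def)
  note off = tilted_offset[OF a, of u, folded w_def]
  have y: "y - a * tent (y + 5/2) + 5/2 = u - a * tent u" by (simp add: u_def)
  have a_eq: "a * (4 * L + 1) = 2 * x" if "0 \<le> x" "x \<le> L"
  proof -
    have "2 * x \<le> 2 * L * 1" using that by simp
    also have "\<dots> \<le> 2 * L * (L + 1 - x)" using that L by (intro mult_left_mono) auto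
    finally show ?thesis using that L by (simp add: a_def tilt_amount_def)
  qed
  have g: "tilted_gauge L (x - (L + 1/2), y - a * tent (y + 5/2) + 5/2, 0) = max (- (x - (L + 1/2)) / (L + 1/2))
      (max (2 * (x - (L + 1/2))) (max (w / (3/2)) (max 0 (min (- 2 * (x - (L + 1/2))) (- 4 * (x - (L + 1/2)) - (8 * L + 2) * w)))))"
    by (simp only: y tilted_gauge_simp w_def abs_zero)
  have left: "- (x - (L + 1/2)) / (L + 1/2) \<le> 1 \<longleftrightarrow> 0 \<le> x" "- (x - (L + 1/2)) / (L + 1/2) = 1 \<longleftrightarrow> x = 0"
    using L by (auto simp: field_simps)
  have right: "2 * (x - (L + 1/2)) \<le> 1 \<longleftrightarrow> x \<le> L + 1" "2 * (x - (L + 1/2)) = 1 \<longleftrightarrow> x = L + 1"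
    by auto
  have outer: "w / (3/2) \<le> 1 \<longleftrightarrow> \<bar>u\<bar> \<le> 3/2" "w / (3/2) = 1 \<longleftrightarrow> \<bar>u\<bar> = 3/2"
    using off by auto
  have notch: "- 4 * (x - (L + 1/2)) - (8 * L + 2) * w \<le> 1 \<longleftrightarrow> 1/2 \<le> \<bar>u\<bar>"
      "- 4 * (x - (L + 1/2)) - (8 * L + 2) * w = 1 \<longleftrightarrow> \<bar>u\<bar> = 1/2" if "0 \<le> x" "x \<le> L"
  proof -
    define d e where "d = 1/2 - a - w" and "e = - 4 * (x - (L + 1/2)) - (8 * L + 2) * w"
    have e: "e - 1 = (8 * L + 2) * d"
      using a_eq[OF that] by (simp add: algebra_simps d_def e_def)
    have p: "8 * L + 2 > 0" using L by simp
    have "(8 * L + 2) * d \<le> 0 \<longleftrightarrow> d \<le> 0" "(8 * L + 2) * d = 0 \<longleftrightarrow> d = 0"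
      using p by (auto simp: mult_le_0_iff)
    then have "e \<le> 1 \<longleftrightarrow> d \<le> 0" "e = 1 \<longleftrightarrow> d = 0" unfolding e[symmetric] by auto
    moreover have "d \<le> 0 \<longleftrightarrow> 1/2 - a \<le> w" "d = 0 \<longleftrightarrow> w = 1/2 - a" by (auto simp: d_def)
    moreover have "1/2 - a \<le> w \<longleftrightarrow> 1/2 \<le> \<bar>u\<bar>" using off(3,4) by argo
    ultimately show "- 4 * (x - (L + 1/2)) - (8 * L + 2) * w \<le> 1 \<longleftrightarrow> 1/2 \<le> \<bar>u\<bar>"
      "- 4 * (x - (L + 1/2)) - (8 * L + 2) * w = 1 \<longleftrightarrow> \<bar>u\<bar> = 1/2"
      unfolding e_def[symmetric] using off(4) by simp_all
  qed
  have max1: "max p q = 1 \<longleftrightarrow> (p \<le> 1 \<and> q \<le> 1 \<and> (p = 1 \<or> q = 1))" for p q :: real by (auto simp: max_def)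
  have min1: "min p q = 1 \<longleftrightarrow> (p \<ge> 1 \<and> q \<ge> 1 \<and> (p = 1 \<or> q = 1))" for p q :: real by (auto simp: min_def)
  have slot: "- 2 * (x - (L + 1/2)) \<le> 1 \<longleftrightarrow> L \<le> x" "- 2 * (x - (L + 1/2)) \<ge> 1 \<longleftrightarrow> x \<le> L" "- 2 * (x - (L + 1/2)) = 1 \<longleftrightarrow> x = L"
    by auto
  have zero: "(0::real) \<le> 1 \<longleftrightarrow> True" "(0::real) = 1 \<longleftrightarrow> False" by auto
  define e where "e = - 4 * (x - (L + 1/2)) - (8 * L + 2) * w"
  have e: "(e \<le> 1 \<longleftrightarrow> 1/2 \<le> \<bar>u\<bar>) \<and> (e = 1 \<longleftrightarrow> \<bar>u\<bar> = 1/2) \<and> (1 \<le> e \<longleftrightarrow> \<bar>u\<bar> \<le> 1/2)" if "0 \<le> x" "x \<le> L"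
    using notch[OF that, folded e_def] by argo
  have "tilted_gauge L (x - (L + 1/2), y - a * tent (y + 5/2) + 5/2, 0) = 1 \<longleftrightarrow>
    (x = 0 \<and> 1/2 \<le> \<bar>u\<bar> \<and> \<bar>u\<bar> \<le> 3/2 \<or>
     0 \<le> x \<and> x \<le> L + 1 \<and> \<bar>u\<bar> = 3/2 \<or>
     0 \<le> x \<and> x \<le> L \<and> \<bar>u\<bar> = 1/2 \<or>
     x = L \<and> \<bar>u\<bar> \<le> 1/2 \<or>
     x = L + 1 \<and> \<bar>u\<bar> \<le> 3/2)"
    unfolding g
  proof (simp only: max1 max.bounded_iff left right outer min1 min_le_iff_disj slot zero simp_thms e_def[symmetric])
    consider "x < 0" | "x = 0" | "0 < x" "x < L" | "x = L" | "L < x" "x < L + 1" | "x = L + 1" | "x > L + 1"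
      by linarith
    then show "(0 \<le> x \<and> (x \<le> L + 1 \<and> \<bar>u\<bar> \<le> 3/2 \<and> (L \<le> x \<or> e \<le> 1)) \<and>
      (x = 0 \<or> x \<le> L + 1 \<and> (\<bar>u\<bar> \<le> 3/2 \<and> (L \<le> x \<or> e \<le> 1)) \<and>
       (x = L + 1 \<or> \<bar>u\<bar> \<le> 3/2 \<and> (L \<le> x \<or> e \<le> 1) \<and>
        (\<bar>u\<bar> = 3/2 \<or> (L \<le> x \<or> e \<le> 1) \<and> x \<le> L \<and> 1 \<le> e \<and> (x = L \<or> e = 1))))) \<longleftrightarrow>
      (x = 0 \<and> 1/2 \<le> \<bar>u\<bar> \<and> \<bar>u\<bar> \<le> 3/2 \<or>
       0 \<le> x \<and> x \<le> L + 1 \<and> \<bar>u\<bar> = 3/2 \<or>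
       0 \<le> x \<and> x \<le> L \<and> \<bar>u\<bar> = 1/2 \<or>
       x = L \<and> \<bar>u\<bar> \<le> 1/2 \<or>
       x = L + 1 \<and> \<bar>u\<bar> \<le> 3/2)"
      by cases (use e L in auto)
  qed
  then show ?thesis
    unfolding slotted_rectangle_iff[of L x y 0, OF less_le_trans[OF zero_less_one L]] a_def u_def by simp
qed

lemma deformable_slotted_rectangle_circle:
  assumes L: "L \<ge> 1"
  shows "deformable (slotted_rectangle L) {v. snd (snd v) = 0 \<and> norm v = 1}"
proof -
  let ?c = "(- (L + 1/2), 5/2, 0) :: space"
  have tilted: "deformable (slotted_rectangle L) (tilt L ` slotted_rectangle L)"
    unfolding deformable_def using compact_homeo_tilt[OF L] by blast
  have shifted: "deformable (tilt L ` slotted_rectangle L) ((+) ?c ` tilt L ` slotted_rectangle L)"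
  proof (rule deformable_translation)
    have "compact (slotted_rectangle L)"
    proof -
      have "rest 4 = (\<lambda>i. (- real i, 0)) ` {1..4}" by (auto simp: rest_def)
      then have "compact ({0..L} \<times> rest 4)" by (simp add: compact_Times finite_imp_compact)
      then show ?thesis
        unfolding slotted_rectangle_def join_12_34_def join_23_14_def by (intro compact_Un compact_segment)
    qed
    moreover have "continuous_on UNIV (tilt L)"
      using compact_homeo_tilt[OF L] by (auto simp: compact_homeo_def homeomorphism_def)
    ultimately show "bounded (tilt L ` slotted_rectangle L)"
      by (meson compact_continuous_image compact_imp_bounded continuous_on_subset subset_UNIV)
  qed
  have level_set: "(+) ?c ` tilt L ` slotted_rectangle L = {v \<in> {v. snd (snd v) = 0}. tilted_gauge L v = 1}"
  proof (intro subset_antisym subsetI)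
    fix v assume "v \<in> (+) ?c ` tilt L ` slotted_rectangle L"
    then obtain x y z where xyz: "(x, y, z) \<in> slotted_rectangle L" "v = ?c + tilt L (x, y, z)" by auto
    then have "z = 0" using slotted_rectangle_iff[of L x y z] L by auto
    then show "v \<in> {v \<in> {v. snd (snd v) = 0}. tilted_gauge L v = 1}"
      using tilted_gauge_tilt[OF L, of x y] xyz by (simp add: tilt_def algebra_simps)
  next
    fix v assume "v \<in> {v \<in> {v. snd (snd v) = 0}. tilted_gauge L v = 1}"
    then have v: "snd (snd v) = 0" "tilted_gauge L v = 1" by auto
    have "surj (tilt L)"
      using compact_homeo_tilt[OF L] by (auto simp: compact_homeo_def homeomorphism_def)
    then obtain x y z where xyz: "tilt L (x, y, z) = v - ?c" by (metis surjD prod_cases3)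
    then have z: "z = 0" using v(1) by (cases v) (auto simp: tilt_def)
    have eq: "v = ?c + tilt L (x, y, 0)" using xyz z by simp
    then have "v = (x - (L + 1/2), y - tilt_amount L x 0 * tent (y + 5/2) + 5/2, 0)"
      by (simp add: tilt_def)
    then have "(x, y, 0) \<in> slotted_rectangle L"
      using tilted_gauge_tilt[OF L, of x y] v(2) by simp
    then show "v \<in> (+) ?c ` tilt L ` slotted_rectangle L"
      using eq by blast
  qed
  have round: "deformable {v \<in> {v. snd (snd v) = 0}. tilted_gauge L v = 1} {v \<in> {v. snd (snd v) = 0}. norm v = 1}"
  proof (rule deformable_gauge_to_unit_sphere)
    show "continuous_on UNIV (tilted_gauge L)"
      unfolding tilted_gauge_def case_prod_beta using L by (intro continuous_intros) auto
    fix t :: real and v :: space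
    obtain x y z where v: "v = (x, y, z)" by (metis prod_cases3)
    { assume t: "0 < t"
      have m: "max (t * p) (t * q) = t * max p q" "min (t * p) (t * q) = t * min p q" for p q
        using t by (simp_all add: max_mult_distrib_left min_mult_distrib_left)
      have "t *\<^sub>R v = (t * x, t * y, t * z)" by (simp add: v)
      moreover have "- (t * x) / (L + 1/2) = t * (- x / (L + 1/2))" "2 * (t * x) = t * (2 * x)"
        "\<bar>t * y\<bar> / (3/2) = t * (\<bar>y\<bar> / (3/2))" "\<bar>t * z\<bar> = t * \<bar>z\<bar>" "- 2 * (t * x) = t * (- 2 * x)"
        "- 4 * (t * x) - (8 * L + 2) * \<bar>t * y\<bar> = t * (- 4 * x - (8 * L + 2) * \<bar>y\<bar>)"
        using t by (simp_all add: abs_mult algebra_simps)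
      ultimately show "tilted_gauge L (t *\<^sub>R v) = t * tilted_gauge L v"
        unfolding v by (simp only: tilted_gauge_simp m) }
    show "0 < tilted_gauge L v" if "v \<noteq> 0"
    proof -
      have "x \<noteq> 0 \<or> y \<noteq> 0 \<or> z \<noteq> 0" using \<open>v \<noteq> 0\<close> by (auto simp: v zero_prod_def)
      then consider "x < 0" | "x > 0" | "y \<noteq> 0" | "z \<noteq> 0" by linarith
      then show ?thesis
      proof cases
        case 1
        then have "- x / (L + 1/2) > 0" using L by (intro divide_pos_pos) auto
        then show ?thesis unfolding v tilted_gauge_simp less_max_iff_disj by blast
      next
        case 2
        then have "2 * x > 0" by simp
        then show ?thesis unfolding v tilted_gauge_simp less_max_iff_disj by blast
      next
        case 3
        then have "\<bar>y\<bar> / (3/2) > 0" by simp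
        then show ?thesis unfolding v tilted_gauge_simp less_max_iff_disj by blast
      next
        case 4
        then have "\<bar>z\<bar> > 0" by simp
        then show ?thesis unfolding v tilted_gauge_simp less_max_iff_disj by blast
      qed
    qed
    show "t *\<^sub>R v \<in> {v. snd (snd v) = 0}" if "v \<in> {v. snd (snd v) = 0}"
      using that by simp
  qed
  have "deformable (slotted_rectangle L) {v \<in> {v. snd (snd v) = 0}. norm v = 1}"
    by (rule deformable_trans[OF deformable_trans[OF tilted shifted[unfolded level_set]] round])
  then show ?thesis by simp
qed

section \<open>The braid word of a Conway normal form\<close>

text \<open>Only the parity of the position \<open>k\<close> matters, so entries at positions of equal parity merge
  once they are adjacent, and opposite ones cancel.\<close>
definition letter :: "nat \<Rightarrow> int \<Rightarrow> nat \<times> int" where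
  "letter k a = (if even k then (2, a) else (1, - a))"

fun word_from :: "nat \<Rightarrow> int list \<Rightarrow> (nat \<times> int) list" where
  "word_from k [] = []"
| "word_from k (a # as) = letter k a # word_from (Suc k) as"

lemma length_word_from [simp]: "length (word_from k as) = length as"
  by (induction as arbitrary: k) auto

lemma word_from_append: "word_from k (as @ bs) = word_from k as @ word_from (k + length as) bs"
  by (induction as arbitrary: k) auto

lemma word_from_nth: "i < length as \<Longrightarrow> word_from k as ! i = letter (k + i) (as ! i)"
  by (induction as arbitrary: k i) (auto simp: nth_Cons split: nat.split)

lemma conway_word_eq: "conway_word as = word_from 0 as"
  by (rule nth_equalityI) (auto simp: conway_word_def word_from_nth letter_def)

lemma letters_below_word_from: "3 \<le> N \<Longrightarrow> letters_below N (word_from k as)"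
  by (induction as arbitrary: k) (auto simp: letters_below_def letter_def)

lemma letters_below_append: "letters_below N (u @ w) \<longleftrightarrow> letters_below N u \<and> letters_below N w"
  by (auto simp: letters_below_def)

lemma end_map_merge:
  assumes "even k = even m"
  shows "end_map [letter k a, letter m b] = end_map [letter m (a + b)]"
  using assms by (auto simp: fun_eq_iff letter_def swirl_add algebra_simps)

lemma end_map_cancel:
  assumes "even k = even m"
  shows "end_map [letter k a, letter m (- a)] = id"
  unfolding end_map_merge[OF assms] by (auto simp: letter_def)

lemma end_map_replace: "end_map v = end_map v' \<Longrightarrow> end_map (u @ v @ w) = end_map (u @ v' @ w)"
  by (simp only: end_map_append)

text \<open>The condition on \<open>m\<close> says that the last letter of the first word and the first letter of the second
  one are powers of the same generator; then the words cancel from the inside.\<close>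
lemma end_map_inverse:
  assumes "even m = odd (k + length as)"
  shows "end_map (word_from k as @ word_from m (rev (map uminus as))) = id"
  using assms
proof (induction as arbitrary: k)
  case (Cons a as)
  let ?w = "word_from (Suc k) as @ word_from m (rev (map uminus as))"
  let ?l = "letter (m + length as) (- a)"
  have "even k = even (m + length as)" using Cons.prems by auto
  then have pair: "end_map ([letter k a] @ [?l]) = id" using end_map_cancel by simp
  have "end_map ?w = end_map []" using Cons.prems by (simp only: end_map.simps, intro Cons.IH) auto
  then have "end_map ([letter k a] @ ?w @ [?l]) = id"
    using end_map_replace[of ?w "[]" "[letter k a]" "[?l]"] pair by (simp only: append_Nil)
  moreover have "word_from k (a # as) @ word_from m (rev (map uminus (a # as))) = [letter k a] @ ?w @ [?l]"
    by (simp add: word_from_append)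
  ultimately show ?case by (simp only:)
qed simp

section \<open>Delta-moves inside a braid\<close>

text \<open>String 4 is straight, and it is the same set for all words of one length.\<close>
lemma braid_4_eq_braid_3:
  assumes w: "letters_below 3 w"
  shows "braid 4 x0 w = braid 3 x0 w \<union> (\<Union>k<length w. {x0 + real k..x0 + real k + 1} \<times> {(- 4, 0)})"
proof -
  have "twist_column 4 x (w ! k) = twist_column 3 x (w ! k) \<union> {x..x + 1} \<times> {(- 4, 0)}" if k: "k < length w" for k x
  proof -
    obtain j a where l: "w ! k = (j, a)" by force
    have j: "1 \<le> j" "j + 1 \<le> 3" using w k l nth_mem[OF k] by (force simp: letters_below_def)+
    then have "{1..4} - {j, j + 1} = insert 4 ({1..3} - {j, j + 1})" by auto
    then have "{(x + t, - real i, 0::real) | i t. i \<in> {1..4} - {j, j + 1} \<and> t \<in> {0..1}} =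
        {(x + t, - real i, 0) | i t. i \<in> {1..3} - {j, j + 1} \<and> t \<in> {0..1}} \<union> {(x + t, - 4 :: real, 0 :: real) | t. t \<in> {0..1}}"
      by force
    moreover have "{(x + t, - 4 :: real, 0 :: real) | t. t \<in> {0..1}} = {x..x + 1} \<times> {(- 4, 0)}"
    proof (intro subset_antisym subsetI)
      fix v assume "v \<in> {x..x + 1} \<times> {(- 4 :: real, 0 :: real)}"
      then show "v \<in> {(x + t, - 4 :: real, 0 :: real) | t. t \<in> {0..1}}"
        by (intro CollectI exI[of _ "fst v - x"]) auto
    qed auto
    ultimately show ?thesis unfolding l twist_column_def case_prod_conv by (simp add: Un_assoc)
  qed
  then show ?thesis unfolding braid_def by (simp add: UN_Un_distrib)
qed

text \<open>Outside the disk the two diagrams agree by construction.  Inside it, string 4 is too low to be seen,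
  and the neighbouring columns contribute only their end points, which the tangle contains as well.\<close>
lemma delta_local_braid:
  fixes J J' :: "space set" and u w t t' :: "(nat \<times> int) list"
  defines "x \<equiv> real (length u)"
  assumes u: "letters_below 4 u" and w: "letters_below 4 w"
    and t: "letters_below 3 t" "length t = 3" and t': "letters_below 3 t'" "length t' = 3"
    and J: "\<And>v. v \<in> J \<Longrightarrow> fst v < x" and J': "\<And>v. v \<in> J' \<Longrightarrow> fst v > x + 3"
    and tangles: "(braid 3 x t, braid 3 x t') \<in> delta_tangles x \<union> (delta_tangles x)\<inverse>"
  shows "delta_local (J \<union> braid 4 0 (u @ t @ w) \<union> J') (J \<union> braid 4 0 (u @ t' @ w) \<union> J')"
proof -
  define E where "E = J \<union> J' \<union> braid 4 0 u \<union> braid 4 (x + 3) w \<union> (\<Union>k<3. {x + real k..x + real k + 1} \<times> {(- 4, 0)})"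
  let ?O = "over_disk x"
  have O: "v \<in> ?O \<longleftrightarrow> x \<le> fst v \<and> fst v \<le> x + 3 \<and> -7/2 \<le> fst (snd v) \<and> fst (snd v) \<le> -1/2" for v
    by (auto simp: over_disk_def mem_Times_iff)
  have rest: "p \<in> rest 3" if p: "p \<in> rest 4" "-7/2 \<le> fst p" for p
  proof -
    obtain i where i: "i \<in> {1..4}" "p = (- real i, 0)" using p(1) unfolding rest_def by blast
    then have "i \<noteq> 4" using p(2) by auto
    then show ?thesis using i by (auto simp: rest_def intro!: exI[of _ i])
  qed
  have E_disk: "E \<inter> ?O \<subseteq> {x, x + 3} \<times> rest 3"
  proof
    fix v assume v: "v \<in> E \<inter> ?O"
    then consider "v \<in> J" | "v \<in> J'" | "v \<in> braid 4 0 u" | "v \<in> braid 4 (x + 3) w" | "fst (snd v) = -4"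
      unfolding E_def by auto
    then show "v \<in> {x, x + 3} \<times> rest 3"
    proof cases
      case 1 then show ?thesis using J[of v] v O[of v] by auto
    next
      case 2 then show ?thesis using J'[of v] v O[of v] by auto
    next
      case 3
      then show ?thesis
        using braid_ends[OF u 3] v O[of v] rest[of "snd v"] by (auto simp: x_def mem_Times_iff)
    next
      case 4
      then show ?thesis
        using braid_ends[OF w 4] v O[of v] rest[of "snd v"] by (auto simp: mem_Times_iff)
    next
      case 5 then show ?thesis using v O[of v] by auto
    qed
  qed
  have D: "J \<union> braid 4 0 (u @ s @ w) \<union> J' = E \<union> braid 3 x s" if "letters_below 3 s" "length s = 3" for s
    using that by (auto simp: E_def braid_append braid_4_eq_braid_3 x_def add.assoc)
  have inner: "braid 3 x s \<subseteq> ?O" "{x, x + 3} \<times> rest 3 \<subseteq> braid 3 x s" if s: "letters_below 3 s" "length s = 3" for s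
  proof -
    show "braid 3 x s \<subseteq> ?O"
    proof
      fix v assume v: "v \<in> braid 3 x s"
      show "v \<in> ?O" using braid_ends(1,2)[OF s(1) v] braid_heights[OF s(1) v] s(2) unfolding O by simp
    qed
    have "s \<noteq> []" using s(2) by auto
    then show "{x, x + 3} \<times> rest 3 \<subseteq> braid 3 x s"
      using rest_subset_braid_left[of 3 s x] rest_subset_braid_right[of 3 s x] s by auto
  qed
  have disk: "(E \<union> braid 3 x s) \<inter> ?O = braid 3 x s" "(E \<union> braid 3 x s) - ?O = E - ?O"
    if "letters_below 3 s" "length s = 3" for s
    using inner[OF that] E_disk by blast+
  show ?thesis
    unfolding delta_local_def D[OF t] D[OF t']
    by (rule exI[of _ x]) (use tangles in \<open>simp add: disk t t'\<close>)
qed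

section \<open>The round circle as a knot\<close>

lemma unknot_eq: "unknot = to_S3 ` {v. snd (snd v) = 0 \<and> norm v = 1}"
proof -
  have "{(x, y, z). x\<^sup>2 + y\<^sup>2 = 1 \<and> z = 0} = {v :: space. snd (snd v) = 0 \<and> norm v = 1}"
    by (auto simp: norm_Pair)
  then show ?thesis by (simp add: unknot_def)
qed

lemma knot_unknot: "knot unknot"
proof -
  define c where "c t = ((cos (2 * pi * t), sin (2 * pi * t), 0::real), 0::real)" for t
  define c' where "c' t = ((- sin (2 * pi * t) * (2 * pi), cos (2 * pi * t) * (2 * pi), 0::real), 0::real)" for t
  have c: "c t = to_S3 (cos (2 * pi * t), sin (2 * pi * t), 0)" for t
    by (simp add: c_def to_S3_def norm_Pair)
  have range: "range c = unknot"
  proof (intro subset_antisym subsetI)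
    fix q assume "q \<in> range c"
    then show "q \<in> unknot" by (auto simp: c unknot_def)
  next
    fix q assume "q \<in> unknot"
    then obtain x y where xy: "q = to_S3 (x, y, 0)" "x\<^sup>2 + y\<^sup>2 = 1" by (auto simp: unknot_def)
    obtain t where "x = cos t" "y = sin t" using sincos_total_2pi[OF xy(2)] by metis
    then have "q = c (t / (2 * pi))" by (simp add: c xy(1))
    then show "q \<in> range c" by blast
  qed
  have deriv: "(c has_vector_derivative c' t) (at t)" for t
    unfolding c_def c'_def
    by (auto intro!: derivative_eq_intros has_vector_derivative_Pair
        simp: has_real_derivative_iff_has_vector_derivative[symmetric])
  have "smooth_closed_curve c"
    unfolding smooth_closed_curve_def
  proof (intro conjI allI)
    show "range c \<subseteq> S3" by (auto simp: c)
    show "c (t + 1) = c t" for t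
      by (simp add: c_def distrib_left)
    show "inj_on c {0..<1}"
    proof (rule inj_onI)
      fix s t assume st: "s \<in> {0..<1}" "t \<in> {0..<1}" "c s = c t"
      then have "cos (2 * pi * s) = cos (2 * pi * t)" "sin (2 * pi * s) = sin (2 * pi * t)"
        by (simp_all add: c_def)
      then obtain k :: int where "2 * pi * s = 2 * pi * t + 2 * pi * k"
        using sin_cos_eq_iff[of "2 * pi * s" "2 * pi * t"] by auto
      then have "2 * pi * (s - t) = 2 * pi * k" by (simp add: algebra_simps)
      then have "s - t = k" by simp
      moreover have "\<bar>s - t\<bar> < 1" using st by auto
      ultimately have "k = 0" by linarith
      then show "s = t" using \<open>s - t = k\<close> by simp
    qed
    show "c C1_differentiable_on UNIV"
      unfolding C1_differentiable_on_def
    proof (intro exI conjI)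
      show "\<forall>t\<in>UNIV. (c has_vector_derivative c' t) (at t)" using deriv by blast
      show "continuous_on UNIV c'" unfolding c'_def by (intro continuous_intros)
    qed
    show "vector_derivative c (at t) \<noteq> 0" for t
      using vector_derivative_at[OF deriv[of t]] sin_zero_abs_cos_one[of "2 * pi * t"] by (auto simp: c'_def zero_prod_def)
  qed
  moreover have "unknot \<subseteq> S3" by (auto simp: unknot_def)
  ultimately show ?thesis
    unfolding knot_def using range ambient_isotopic_refl by metis
qed

section \<open>One move suffices\<close>

lemma delta_unknotting_number_eq_1:
  assumes "delta_move K unknot" "\<not> trivial_knot K"
  shows "delta_unknotting_number K = 1"
  unfolding delta_unknotting_number_def delta_gordian_distance_def
proof (rule antisym)
  have "(delta_move ^^ 1 OO ambient_isotopic) K unknot"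
    using assms(1) ambient_isotopic_refl by auto
  then have "(INF m \<in> {m. (delta_move ^^ m OO ambient_isotopic) K unknot}. enat m) \<le> enat 1"
    by (intro INF_lower) simp
  then show "(INF m \<in> {m. (delta_move ^^ m OO ambient_isotopic) K unknot}. enat m) \<le> 1"
    by (simp add: one_enat_def)
  have "\<not> ambient_isotopic K unknot"
    using assms by (auto simp: trivial_knot_def delta_move_def)
  then have "m \<noteq> 0" if "(delta_move ^^ m OO ambient_isotopic) K unknot" for m
    using that by (metis relpowp_0_E relcomppE)
  then show "1 \<le> (INF m \<in> {m. (delta_move ^^ m OO ambient_isotopic) K unknot}. enat m)"
    by (intro INF_greatest) (simp add: one_enat_def Suc_le_eq)
qed

theorem theorem1p4:
  fixes n :: nat and \<beta> :: int and b :: "nat \<Rightarrow> int"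
  assumes "n \<ge> 1"
    and K: "K = conway ([\<beta>] @ map b (rev [1..<n + 1]) @ [1, 1, 1, 1, 1] @
                        [1 - b 1] @ map (\<lambda>i. - b i) [2..<n + 1])"
    and "two_bridge_knot K"
    and "\<not> trivial_knot K"
  shows "delta_unknotting_number K = 1"
proof -
  define as where "as = \<beta> # map b (rev [1..<n + 1])"
  define bs where "bs = map (\<lambda>i. - b i) [2..<n + 1]"
  define u where "u = word_from 0 as @ [letter (n + 1) 1]"
  define t where "t = word_from (n + 2) [1, 1, 1]"
  \<comment> \<open>Shifting the position by one and changing the sign exchanges the two generators and keeps the direction of the twists: these are the letters of the other tangle.\<close>
  define t' where "t' = word_from (n + 3) [-1, -1, -1]"
  define w where "w = [letter (n + 5) 1, letter (n + 6) (1 - b 1)] @ word_from (n + 7) bs"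
  define L where "L = real (2 * n + 6)"
  define J where "J = join_12_34 0"
  define J' where "J' = join_23_14 L"
  have len: "length as = n + 1" "length bs = n - 1" "length u = n + 2" "length t = 3" "length t' = 3" "length w = n + 1"
    using \<open>n \<ge> 1\<close> by (simp_all add: as_def bs_def u_def t_def t'_def w_def del: upt_Suc)
  have word: "conway_word (as @ [1, 1, 1, 1, 1] @ [1 - b 1] @ bs) = u @ t @ w"
    unfolding conway_word_eq word_from_append len by (simp add: u_def t_def w_def eval_nat_numeral)
  have "K = to_S3 ` conway_diagram (as @ [1, 1, 1, 1, 1] @ [1 - b 1] @ bs)"
    unfolding K conway_def as_def bs_def by simp
  also have "conway_diagram (as @ [1, 1, 1, 1, 1] @ [1 - b 1] @ bs) = J \<union> braid 4 0 (u @ t @ w) \<union> J'"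
  proof -
    have "length (as @ [1, 1, 1, 1, 1] @ [1 - b 1] @ bs) = 2 * n + 6" using len \<open>n \<ge> 1\<close> by simp
    then show ?thesis unfolding conway_diagram_def word by (simp add: J_def J'_def L_def add.commute)
  qed
  finally have K_eq: "K = to_S3 ` (J \<union> braid 4 0 (u @ t @ w) \<union> J')" .
  have below: "letters_below 4 u" "letters_below 4 w" "letters_below 3 t" "letters_below 3 t'" "letters_below 4 t'"
    unfolding u_def w_def t_def t'_def letters_below_append
    by (simp_all add: letters_below_word_from) (auto simp: letters_below_def letter_def)

  have "delta_local (J \<union> braid 4 0 (u @ t @ w) \<union> J') (J \<union> braid 4 0 (u @ t' @ w) \<union> J')"
  proof (rule delta_local_braid)
    show "fst v < real (length u)" if "v \<in> J" for v
      using that by (auto simp: J_def join_12_34_def vertical_segment len)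
    show "real (length u) + 3 < fst v" if "v \<in> J'" for v
      using that \<open>n \<ge> 1\<close> by (auto simp: J'_def L_def join_23_14_def vertical_segment horizontal_segment len)
    show "(braid 3 (real (length u)) t, braid 3 (real (length u)) t') \<in>
        delta_tangles (real (length u)) \<union> (delta_tangles (real (length u)))\<inverse>"
    proof (cases "even n")
      case True
      then have "t = [(2, 1), (1, -1), (2, 1)]" "t' = [(1, 1), (2, -1), (1, 1)]"
        by (simp_all add: t_def t'_def letter_def)
      then show ?thesis unfolding delta_tangles_def by force
    next
      case False
      then have "t = [(1, -1), (2, 1), (1, -1)]" "t' = [(2, -1), (1, 1), (2, -1)]"
        by (simp_all add: t_def t'_def letter_def)
      then show ?thesis unfolding delta_tangles_def by force
    qed
  qed (use below len in auto)
  moreover have "ambient_isotopic unknot (to_S3 ` (J \<union> braid 4 0 (u @ t' @ w) \<union> J'))"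
  proof -
    have inv: "rev (map uminus as) = - b 1 # bs @ [- \<beta>]"
    proof -
      have "[1..<n + 1] = 1 # [2..<n + 1]" using \<open>n \<ge> 1\<close> by (simp add: upt_conv_Cons eval_nat_numeral)
      then show ?thesis by (simp add: as_def bs_def rev_map[symmetric])
    qed
    have last: "letter (n + 7 + length bs) (- \<beta>) = (2, - \<beta>)"
      using len \<open>n \<ge> 1\<close> by (simp add: letter_def)
    have "end_map (word_from 0 as @ word_from (n + 6) (- b 1 # bs @ [- \<beta>])) = id"
      unfolding inv[symmetric] using len by (intro end_map_inverse) simp
    moreover have "word_from (n + 6) (- b 1 # bs @ [- \<beta>]) = [letter (n + 6) (- b 1)] @ word_from (n + 7) bs @ [(2, - \<beta>)]"
    proof -
      have "Suc (n + 6) = n + 7" by simp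
      then show ?thesis by (simp only: word_from.simps word_from_append last append_Cons append_Nil)
    qed
    ultimately have reduced: "end_map (word_from 0 as @ [letter (n + 6) (- b 1)] @ word_from (n + 7) bs @ [(2, - \<beta>)]) = id"
      by (simp only:)
    define v where "v = word_from (n + 7) bs @ [(2, - \<beta>)]"
    \<comment> \<open>\<open>\<sigma>\<^sub>k\<^sup>-\<^sup>s \<sigma>\<^sub>k\<^sup>s\<close> at the left end of the new tangle, \<open>\<sigma>\<^sub>k\<^sup>s \<sigma>\<^sub>k\<^sup>-\<^sup>s\<close> at its right end; then \<open>\<sigma>\<^sub>j\<^sup>-\<^sup>s\<close> joins the letter of \<open>1 - \<beta>\<^sub>1\<close>.\<close>
    have cancel1: "end_map [letter (n + 1) 1, letter (n + 3) (- 1)] = end_map []"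
      using end_map_cancel[of "n + 1" "n + 3" 1] by simp
    have cancel2: "end_map [letter (n + 5) (- 1), letter (n + 5) 1] = end_map []"
      using end_map_cancel[of "n + 5" "n + 5" "- 1"] by simp
    have merge: "end_map [letter (n + 4) (- 1), letter (n + 6) (1 - b 1)] = end_map [letter (n + 6) (- b 1)]"
      using end_map_merge[of "n + 4" "n + 6" "- 1" "1 - b 1"] by simp
    have "Suc (n + 3) = n + 4" "Suc (n + 4) = n + 5" by simp_all
    then have t'_eq: "t' = [letter (n + 3) (- 1), letter (n + 4) (- 1), letter (n + 5) (- 1)]"
      by (simp only: t'_def word_from.simps)
    have split: "(u @ t' @ w) @ [(2, - \<beta>)] = word_from 0 as @ [letter (n + 1) 1, letter (n + 3) (- 1)] @
        ([letter (n + 4) (- 1)] @ [letter (n + 5) (- 1), letter (n + 5) 1] @ [letter (n + 6) (1 - b 1)] @ v)"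
      by (simp only: u_def t'_eq w_def v_def append_assoc append_Cons append_Nil)
    have "end_map ((u @ t' @ w) @ [(2, - \<beta>)]) = end_map (word_from 0 as @ [] @
        ([letter (n + 4) (- 1)] @ [letter (n + 5) (- 1), letter (n + 5) 1] @ [letter (n + 6) (1 - b 1)] @ v))"
      unfolding split by (rule end_map_replace[OF cancel1])
    also have "\<dots> = end_map ((word_from 0 as @ [letter (n + 4) (- 1)]) @
        [letter (n + 5) (- 1), letter (n + 5) 1] @ ([letter (n + 6) (1 - b 1)] @ v))"
      by (simp only: append_assoc append_Nil)
    also have "\<dots> = end_map ((word_from 0 as @ [letter (n + 4) (- 1)]) @ [] @ ([letter (n + 6) (1 - b 1)] @ v))"
      by (rule end_map_replace[OF cancel2])
    also have "\<dots> = end_map (word_from 0 as @ [letter (n + 4) (- 1), letter (n + 6) (1 - b 1)] @ v)"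
      by (simp only: append_assoc append_Nil append_Cons)
    also have "\<dots> = end_map (word_from 0 as @ [letter (n + 6) (- b 1)] @ v)"
      by (rule end_map_replace[OF merge])
    also have "\<dots> = id" unfolding v_def by (rule reduced)
    finally have trivial: "end_map ((u @ t' @ w) @ [(2, - \<beta>)]) = id" .
    have below': "letters_below 4 (u @ t' @ w)" using below by (simp only: letters_below_append)
    have nonempty: "u @ t' @ w \<noteq> []" using len(3) by auto
    have "L = real (length (u @ t' @ w))" using len by (simp add: L_def)
    then have "braid_homeo 0 ((u @ t' @ w) @ [(2, - \<beta>)]) ` slotted_rectangle L = J \<union> braid 4 0 (u @ t' @ w) \<union> J'"
      unfolding J_def J'_def using braid_homeo_slotted_rectangle[OF below' nonempty trivial] by (simp only:)
    moreover have "compact_homeo (braid_homeo 0 ((u @ t' @ w) @ [(2, - \<beta>)]))"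
      by (rule compact_homeo_braid_homeo[OF trivial])
    ultimately have "deformable (slotted_rectangle L) (J \<union> braid 4 0 (u @ t' @ w) \<union> J')"
      unfolding deformable_def by blast
    moreover have "deformable (slotted_rectangle L) {v. snd (snd v) = 0 \<and> norm v = 1}"
      by (rule deformable_slotted_rectangle_circle) (simp add: L_def)
    ultimately show ?thesis
      unfolding unknot_eq using deformable_sym deformable_trans deformable_imp_ambient_isotopic by blast
  qed
  moreover have "knot K" using \<open>two_bridge_knot K\<close> by (simp add: two_bridge_knot_def)
  ultimately have "delta_move K unknot"
    unfolding delta_move_def using knot_unknot K_eq ambient_isotopic_refl by blast
  then show ?thesis using \<open>\<not> trivial_knot K\<close> by (rule delta_unknotting_number_eq_1)
qed

end
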